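(* Let $\mathcal H_1=\{H_1^y\}$ and $\mathcal H_2=\{H_2^y\}$ be two ramification data over the same effective divisor $D$ with $H_1^y=1$ for all $y\in\operatorname{supp}D$, $y\neq x$, and $H_1^x=H_2^x$ (if $x\in\operatorname{supp}D$). Let $\Gamma_D^{\mathcal H_1}$, $\Gamma_D^{\mathcal H_2}$ be the corresponding Hecke graphs at $x$ for a dominant cocharacter $\mu$. Then the natural map on vertices $\Gamma_D^{\mathcal H_1}\to\Gamma_D^{\mathcal H_2}$ (extending level structures from $H_1^y$ to $H_2^y$) is surjective, so that the vertices of $\Gamma_D^{\mathcal H_2}$ are obtained by identifying vertices of $\Gamma_D^{\mathcal H_1}$, and it induces a bijection on edges in the following sense: for all vertices $a,b$ of $\Gamma_D^{\mathcal H_2}$ and every lift $\tilde a$ of $a$ to $\Gamma_D^{\mathcal H_1}$, it induces a bijection between the set of edges from $\tilde a$ to all lifts of $b$ in $\Gamma_D^{\mathcal H_1}$ and the set of edges $a\to b$ in $\Gamma_D^{\mathcal H_2}$.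
   Context: $X$ is a smooth projective geometrically connected curve over a finite field $k$ with function field $F$ and adele ring $\mathbb A$; $x$ is a fixed closed point. For a closed point $y$, $\mathcal O_y$ is the completed local ring and $\pi_y$ a uniformizer. $G$ is a connected split reductive group over $k$ with split maximal torus $T$, and $\mu$ is a dominant cocharacter of $T$. A ramification datum over $D=\sum_yd_y[y]$ is a choice of an algebraic subgroup $H^y\subset G$ for each $y\in\operatorname{supp}D$. The associated compact open subgroup is $K_{\mathcal H}(D)=\prod_yK_y$, where $K_y\subset G(\mathcal O_y)$ is the preimage of $H^y(\mathcal O_y/\pi_y^{d_y})$ if $y\in\operatorname{supp}D$ and $K_y=G(\mathcal O_y)$ otherwise. Hecke graph $\Gamma_D^{\mathcal H}$: with $K=K_{\mathcal H}(D)$, the vertices are $G(F)\backslash G(\mathbb A)/K$ (equivalently, isomorphism classes of $G$-bundles on $X$ with a reduction to $H^y$ over $\mathcal O_y/\pi_y^{d_y}$ for every $y\in\operatorname{supp}D$). Let $\Delta\in G(\mathbb A)$ have $\Delta_x=\mu(\pi_x)$ and $\Delta_y=1$ for $y\neq x$. The edges out of the class of $g$ are indexed by cosets $\sigma K\in K\Delta K/K$, the edge $\sigma K$ going to the class of $g\sigma$ (multiple edges allowed). *)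

theory Defs
  imports
    "HOL-Analysis.Cartesian_Space"
    "HOL-Library.Poly_Mapping"
    "HOL-Library.Product_Plus"
    "HOL-Algebra.Algebraic_Closure_Type"
    "HOL-Algebra.Product_Groups"
    "HOL-Algebra.Solvable_Groups"
    "Graph_Theory.Digraph"
begin

section \<open>Polynomials and group algebras\<close>

text \<open>
  Polynomials in variables \<open>'v\<close> and group algebras \<open>k[M]\<close> of a character group \<open>M\<close> are both
  finitely supported functions with the convolution product: the monomials are \<open>'v \<Rightarrow>\<^sub>0 nat\<close>,
  respectively the elements of \<open>M\<close>.  So \<open>int \<Rightarrow>\<^sub>0 'k\<close> is \<open>k[t, 1/t]\<close>.
\<close>

type_synonym ('v, 'k) mpoly = "('v \<Rightarrow>\<^sub>0 nat) \<Rightarrow>\<^sub>0 'k"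

abbreviation TR :: "'a::comm_ring_1 ring"
  where "TR \<equiv> ring_of_type_algebra"

abbreviation cst :: "'k::zero \<Rightarrow> ('m::zero \<Rightarrow>\<^sub>0 'k)"
  where "cst \<equiv> Poly_Mapping.single 0"

abbreviation var :: "'v \<Rightarrow> ('v, 'k::zero_neq_one) mpoly"
  where "var v \<equiv> Poly_Mapping.single (Poly_Mapping.single v 1) 1"

text \<open>The value of a polynomial at the point \<open>a\<close> of a \<open>k\<close>-algebra \<open>R\<close> with structure map \<open>\<phi>\<close>.\<close>

definition mpoly_eval ::
  "('r, 's) ring_scheme \<Rightarrow> ('k::zero \<Rightarrow> 'r) \<Rightarrow> ('v \<Rightarrow> 'r) \<Rightarrow> ('v, 'k) mpoly \<Rightarrow> 'r"
  where "mpoly_eval R \<phi> a p =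
    (\<Oplus>\<^bsub>R\<^esub>m\<in>Poly_Mapping.keys p. \<phi> (Poly_Mapping.lookup p m) \<otimes>\<^bsub>R\<^esub>
       (\<Otimes>\<^bsub>R\<^esub>v\<in>Poly_Mapping.keys m. a v [^]\<^bsub>R\<^esub> Poly_Mapping.lookup m v))"

definition push :: "('a \<Rightarrow> 'b) \<Rightarrow> ('a \<Rightarrow>\<^sub>0 'k::comm_monoid_add) \<Rightarrow> ('b \<Rightarrow>\<^sub>0 'k)"
  where "push h p =
    (\<Sum>m\<in>Poly_Mapping.keys p. Poly_Mapping.single (h m) (Poly_Mapping.lookup p m))"

definition homogeneous :: "nat \<Rightarrow> ('v::finite, 'k::zero) mpoly \<Rightarrow> bool"
  where "homogeneous d p \<longleftrightarrow>
    (\<forall>m\<in>Poly_Mapping.keys p. (\<Sum>v\<in>UNIV. Poly_Mapping.lookup m v) = d)"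

text \<open>Dual numbers; the pair \<open>(a, b)\<close> is \<open>a + b \<epsilon>\<close>.\<close>

definition dual_ring :: "('a::comm_ring_1 \<times> 'a) ring"
  where "dual_ring =
    \<lparr>carrier = UNIV, monoid.mult = (\<lambda>(a, b) (c, d). (a * c, a * d + b * c)),
     one = (1, 0), ring.zero = (0, 0), add = (\<lambda>(a, b) (c, d). (a + c, b + d))\<rparr>"

section \<open>The curve\<close>

text \<open>
  A projective variety \<open>X\<close> over \<open>k\<close> with function field \<open>F\<close> is given by an embedding into
  projective space (with coordinates indexed by \<open>'m\<close>), encoded by its generic point \<open>\<xi>\<close>, the
  homogeneous coordinate vector in \<open>F\<close>; \<open>\<iota>\<close> is the inclusion of \<open>k\<close> into \<open>F\<close>.  The homogeneous
  ideal of \<open>X\<close> is generated by the forms vanishing at \<open>\<xi>\<close>.  Every integral projective variety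
  arises in this way, and smooth geometrically connected varieties are integral.
\<close>

definition vanishing_forms ::
  "('k::field \<Rightarrow> 'f::field) \<Rightarrow> ('m::finite \<Rightarrow> 'f) \<Rightarrow> ('m, 'k) mpoly set"
  where "vanishing_forms \<iota> \<xi> = {f. (\<exists>d. homogeneous d f) \<and> mpoly_eval TR \<iota> \<xi> f = 0}"

text \<open>Homogeneous coordinate vectors of the points of \<open>X\<close> over the algebraic closure of \<open>k\<close>.\<close>

definition geometric_points ::
  "('k::field \<Rightarrow> 'f::field) \<Rightarrow> ('m::finite \<Rightarrow> 'f) \<Rightarrow> ('m \<Rightarrow> 'k alg_closure) set"
  where "geometric_points \<iota> \<xi> =
    {P. P \<noteq> (\<lambda>_. 0) \<and> (\<forall>f\<in>vanishing_forms \<iota> \<xi>. mpoly_eval TR to_ac P f = 0)}"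

definition projective_closed :: "('m::finite \<Rightarrow> 'K::field) set \<Rightarrow> bool"
  where "projective_closed Z \<longleftrightarrow>
    (\<exists>S :: ('m, 'K) mpoly set. (\<forall>f\<in>S. \<exists>d. homogeneous d f) \<and>
       Z = {P. P \<noteq> (\<lambda>_. 0) \<and> (\<forall>f\<in>S. mpoly_eval TR id P f = 0)})"

text \<open>
  Connectedness of a subset for the topology whose closed sets are those satisfying \<open>closed_set\<close>.
\<close>

definition connected_for :: "('a set \<Rightarrow> bool) \<Rightarrow> 'a set \<Rightarrow> bool"
  where "connected_for closed_set S \<longleftrightarrow> S \<noteq> {} \<and>
    (\<forall>A B. closed_set A \<longrightarrow> closed_set B \<longrightarrow> S \<subseteq> A \<union> B \<longrightarrow> S \<inter> A \<inter> B = {} \<longrightarrow>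
       S \<inter> A = {} \<or> S \<inter> B = {})"

text \<open>
  Tangent space at \<open>P\<close> of the affine cone over \<open>X\<close>: the vectors \<open>w\<close> with \<open>f (P + \<epsilon> w) = 0\<close> for all
  \<open>f\<close> in the ideal.  Its dimension is one more than that of the tangent space of \<open>X\<close> at \<open>P\<close>.
\<close>

definition cone_tangent_space ::
  "('k::field \<Rightarrow> 'f::field) \<Rightarrow> ('m::finite \<Rightarrow> 'f) \<Rightarrow> ('m \<Rightarrow> 'k alg_closure) \<Rightarrow> ('k alg_closure ^ 'm) set"
  where "cone_tangent_space \<iota> \<xi> P =
    {w. \<forall>f\<in>vanishing_forms \<iota> \<xi>.
       mpoly_eval dual_ring (\<lambda>c. (to_ac c, 0)) (\<lambda>i. (P i, w $ i)) f = (0, 0)}"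

definition transcendence_degree_one :: "('k::field \<Rightarrow> 'f::field) \<Rightarrow> bool"
  where "transcendence_degree_one \<iota> \<longleftrightarrow>
    (\<exists>t. (\<forall>p :: 'k poly. p \<noteq> 0 \<longrightarrow> poly (map_poly \<iota> p) t \<noteq> 0) \<and>
       (\<forall>a. \<exists>q :: 'k poly poly. q \<noteq> 0 \<and> poly (map_poly (\<lambda>c. poly (map_poly \<iota> c) t) q) a = 0))"

definition smooth_projective_geom_connected_curve ::
  "('k::field \<Rightarrow> 'f::field) \<Rightarrow> ('m::finite \<Rightarrow> 'f) \<Rightarrow> bool"
  where "smooth_projective_geom_connected_curve \<iota> \<xi> \<longleftrightarrow>
    \<iota> \<in> ring_hom TR TR \<and>
    \<xi> \<noteq> (\<lambda>_. 0) \<and>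
    (\<forall>a. \<exists>d f g. homogeneous d f \<and> homogeneous d g \<and> mpoly_eval TR \<iota> \<xi> g \<noteq> 0 \<and>
       a = mpoly_eval TR \<iota> \<xi> f / mpoly_eval TR \<iota> \<xi> g) \<and>
    transcendence_degree_one \<iota> \<and>
    (\<forall>P\<in>geometric_points \<iota> \<xi>. vec.dim (cone_tangent_space \<iota> \<xi> P) = 2) \<and>
    connected_for projective_closed (geometric_points \<iota> \<xi>)"

definition local_ring ::
  "('k::field \<Rightarrow> 'f::field) \<Rightarrow> ('m::finite \<Rightarrow> 'f) \<Rightarrow> ('m \<Rightarrow> 'k alg_closure) \<Rightarrow> 'f set"
  where "local_ring \<iota> \<xi> P =
    {mpoly_eval TR \<iota> \<xi> f / mpoly_eval TR \<iota> \<xi> g | f g d.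
       homogeneous d f \<and> homogeneous d g \<and> mpoly_eval TR to_ac P g \<noteq> 0}"

definition normalized_valuation :: "('f::field \<Rightarrow> int) \<Rightarrow> bool"
  where "normalized_valuation v \<longleftrightarrow>
    v 0 = 0 \<and>
    (\<forall>a b. a \<noteq> 0 \<longrightarrow> b \<noteq> 0 \<longrightarrow> v (a * b) = v a + v b) \<and>
    (\<forall>a b. a \<noteq> 0 \<longrightarrow> b \<noteq> 0 \<longrightarrow> a + b \<noteq> 0 \<longrightarrow> min (v a) (v b) \<le> v (a + b)) \<and>
    (\<exists>a. a \<noteq> 0 \<and> v a = 1)"

text \<open>\<open>v a \<ge> N\<close>, where the value at \<open>0\<close> counts as infinite (the convention \<open>v 0 = 0\<close> is a dummy).\<close>

definition val_ge :: "('f::field \<Rightarrow> int) \<Rightarrow> int \<Rightarrow> 'f \<Rightarrow> bool"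
  where "val_ge v N a \<longleftrightarrow> a = 0 \<or> N \<le> v a"

text \<open>
  A closed point is a Galois orbit of geometric points.  It is determined by its local ring, which
  by smoothness is a discrete valuation ring, and hence by the normalized valuation of \<open>F\<close> with
  that valuation ring.
\<close>

definition closed_points ::
  "('k::field \<Rightarrow> 'f::field) \<Rightarrow> ('m::finite \<Rightarrow> 'f) \<Rightarrow> ('f \<Rightarrow> int) set"
  where "closed_points \<iota> \<xi> =
    {v. normalized_valuation v \<and> (\<exists>P\<in>geometric_points \<iota> \<xi>. {a. val_ge v 0 a} = local_ring \<iota> \<xi> P)}"

section \<open>Completions\<close>

definition cauchy_ring :: "('f::field \<Rightarrow> int) \<Rightarrow> (nat \<Rightarrow> 'f) ring"
  where "cauchy_ring v =
    \<lparr>carrier = {s. \<forall>N. \<exists>M. \<forall>i\<ge>M. \<forall>j\<ge>M. val_ge v N (s i - s j)},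
     monoid.mult = (\<lambda>s t i. s i * t i), one = (\<lambda>_. 1),
     ring.zero = (\<lambda>_. 0), add = (\<lambda>s t i. s i + t i)\<rparr>"

definition null_sequences :: "('f::field \<Rightarrow> int) \<Rightarrow> (nat \<Rightarrow> 'f) set"
  where "null_sequences v = {s. \<forall>N. \<exists>M. \<forall>i\<ge>M. val_ge v N (s i)}"

definition completion :: "('f::field \<Rightarrow> int) \<Rightarrow> (nat \<Rightarrow> 'f) set ring"
  where "completion v = cauchy_ring v Quot null_sequences v"

definition to_completion :: "('f::field \<Rightarrow> int) \<Rightarrow> 'f \<Rightarrow> (nat \<Rightarrow> 'f) set"
  where "to_completion v a = null_sequences v +>\<^bsub>cauchy_ring v\<^esub> (\<lambda>_. a)"

text \<open>The completed local ring: limits of Cauchy sequences in the local ring at \<open>v\<close>.\<close>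

definition completed_local_ring :: "('f::field \<Rightarrow> int) \<Rightarrow> (nat \<Rightarrow> 'f) set ring"
  where "completed_local_ring v =
    (completion v)\<lparr>carrier := {C \<in> carrier (completion v). \<exists>s\<in>C. \<forall>i. val_ge v 0 (s i)}\<rparr>"

definition uniformizer :: "('f::field \<Rightarrow> int) \<Rightarrow> (nat \<Rightarrow> 'f) set \<Rightarrow> bool"
  where "uniformizer v p \<longleftrightarrow> p \<in> carrier (completed_local_ring v) \<and>
    maximalideal (PIdl\<^bsub>completed_local_ring v\<^esub> p) (completed_local_ring v)"

section \<open>Algebraic groups\<close>

text \<open>
  Algebraic groups are closed subgroup schemes of \<open>GL\<^sub>n\<close> with \<open>n = CARD('n)\<close>, given by their ideals.
  The coordinate ring of \<open>GL\<^sub>n\<close> is presented as \<open>k[x, y] / (x y = y x = 1)\<close> for two generic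
  matrices \<open>x\<close>, \<open>y\<close>: the variable \<open>Inl (i, j)\<close> is the entry of \<open>x = g\<close> and \<open>Inr (i, j)\<close> that of
  \<open>y\<close>, the inverse of \<open>g\<close>.
\<close>

type_synonym 'n gl_var = "('n \<times> 'n) + ('n \<times> 'n)"
type_synonym ('n, 'k) gl_poly = "('n gl_var, 'k) mpoly"
type_synonym ('n, 'r) mat = "'n \<Rightarrow> 'n \<Rightarrow> 'r"

definition mat_monoid :: "('r, 's) ring_scheme \<Rightarrow> ('n::finite, 'r) mat monoid"
  where "mat_monoid R =
    \<lparr>carrier = {A. \<forall>i j. A i j \<in> carrier R},
     monoid.mult = (\<lambda>A B i j. \<Oplus>\<^bsub>R\<^esub>l\<in>UNIV. A i l \<otimes>\<^bsub>R\<^esub> B l j),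
     one = (\<lambda>i j. if i = j then \<one>\<^bsub>R\<^esub> else \<zero>\<^bsub>R\<^esub>)\<rparr>"

definition GL :: "('r, 's) ring_scheme \<Rightarrow> ('n::finite, 'r) mat monoid"
  where "GL R = units_of (mat_monoid R)"

definition gl_coords :: "('r, 's) ring_scheme \<Rightarrow> ('n::finite, 'r) mat \<Rightarrow> 'n gl_var \<Rightarrow> 'r"
  where "gl_coords R g =
    case_sum (\<lambda>(i, j). g i j) (\<lambda>(i, j). (inv\<^bsub>mat_monoid R\<^esub> g) i j)"

text \<open>The group \<open>G(R)\<close> of points of the group with ideal \<open>I\<close> in a \<open>k\<close>-algebra \<open>R\<close>.\<close>

definition grp_points ::
  "('r, 's) ring_scheme \<Rightarrow> ('k::zero \<Rightarrow> 'r) \<Rightarrow> ('n::finite, 'k) gl_poly set \<Rightarrow> ('n, 'r) mat monoid"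
  where "grp_points R \<phi> I =
    (GL R)\<lparr>carrier :=
      {g \<in> carrier (GL R). \<forall>f\<in>I. mpoly_eval R \<phi> (gl_coords R g) f = \<zero>\<^bsub>R\<^esub>}\<rparr>"

definition gl_relations :: "('n::finite, 'k::comm_ring_1) gl_poly set"
  where "gl_relations =
    range (\<lambda>(i, j). (\<Sum>l\<in>UNIV. var (Inl (i, l)) * var (Inr (l, j))) - (if i = j then 1 else 0)) \<union>
    range (\<lambda>(i, j). (\<Sum>l\<in>UNIV. var (Inr (i, l)) * var (Inl (l, j))) - (if i = j then 1 else 0))"

definition counit :: "('n::finite, 'k::comm_ring_1) gl_poly \<Rightarrow> 'k"
  where "counit =
    mpoly_eval TR id (case_sum (\<lambda>(i, j). if i = j then 1 else 0) (\<lambda>(i, j). if i = j then 1 else 0))"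

definition antipode :: "('n::finite, 'k::comm_ring_1) gl_poly \<Rightarrow> ('n, 'k) gl_poly"
  where "antipode = mpoly_eval TR cst (case_sum (\<lambda>c. var (Inr c)) (\<lambda>c. var (Inl c)))"

text \<open>
  The tensor square of the coordinate ring is presented by polynomials in two copies of the
  coordinates, those of \<open>g\<close> (variables \<open>Inl\<close>) and \<open>h\<close> (variables \<open>Inr\<close>);
  \<open>comult f\<close> is \<open>f (g h)\<close>, \<open>left_factor f\<close> is \<open>f (g)\<close> and \<open>right_factor f\<close> is \<open>f (h)\<close>.
\<close>

definition left_factor ::
  "('n::finite, 'k::comm_ring_1) gl_poly \<Rightarrow> ('n gl_var + 'n gl_var, 'k) mpoly"
  where "left_factor = mpoly_eval TR cst (\<lambda>c. var (Inl c))"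

definition right_factor ::
  "('n::finite, 'k::comm_ring_1) gl_poly \<Rightarrow> ('n gl_var + 'n gl_var, 'k) mpoly"
  where "right_factor = mpoly_eval TR cst (\<lambda>c. var (Inr c))"

definition comult ::
  "('n::finite, 'k::comm_ring_1) gl_poly \<Rightarrow> ('n gl_var + 'n gl_var, 'k) mpoly"
  where "comult = mpoly_eval TR cst
    (case_sum
      (\<lambda>(i, j). \<Sum>l\<in>UNIV. var (Inl (Inl (i, l))) * var (Inr (Inl (l, j))))
      (\<lambda>(i, j). \<Sum>l\<in>UNIV. var (Inr (Inr (i, l))) * var (Inl (Inr (l, j)))))"

text \<open>The ideal of the product of two copies of the group with ideal \<open>I\<close>.\<close>

definition square_ideal ::
  "('n::finite, 'k::comm_ring_1) gl_poly set \<Rightarrow> ('n gl_var + 'n gl_var, 'k) mpoly set"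
  where "square_ideal I = Idl\<^bsub>TR\<^esub> (left_factor ` I \<union> right_factor ` I)"

text \<open>\<open>I\<close> defines a closed subgroup scheme (not necessarily reduced): it is a Hopf ideal.\<close>

definition algebraic_subgroup :: "('n::finite, 'k::field) gl_poly set \<Rightarrow> bool"
  where "algebraic_subgroup I \<longleftrightarrow>
    ideal I TR \<and> gl_relations \<subseteq> I \<and>
    (\<forall>f\<in>I. counit f = 0) \<and> (\<forall>f\<in>I. antipode f \<in> I) \<and> (\<forall>f\<in>I. comult f \<in> square_ideal I)"

text \<open>The subgroup with ideal \<open>J\<close> is contained in the one with ideal \<open>I\<close>.\<close>

definition algebraic_subgroup_of ::
  "('n::finite, 'k::field) gl_poly set \<Rightarrow> ('n, 'k) gl_poly set \<Rightarrow> bool"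
  where "algebraic_subgroup_of J I \<longleftrightarrow> algebraic_subgroup J \<and> I \<subseteq> J"

definition trivial_subgroup :: "('n::finite, 'k::field) gl_poly set"
  where "trivial_subgroup = {f. counit f = 0}"

definition base_change :: "('n::finite, 'k::field) gl_poly set \<Rightarrow> ('n, 'k alg_closure) gl_poly set"
  where "base_change I = Idl\<^bsub>TR\<^esub> (Poly_Mapping.map to_ac ` I)"

subsection \<open>Reductive groups and Borel subgroups\<close>

text \<open>
  A group scheme of finite type over a field is smooth iff it is geometrically reduced.
\<close>

definition smooth_group :: "('n::finite, 'k::field) gl_poly set \<Rightarrow> bool"
  where "smooth_group I \<longleftrightarrow> (\<forall>f m. f ^ m \<in> base_change I \<longrightarrow> f \<in> base_change I)"

text \<open>
  Smooth closed subgroups over the algebraic closure are identified with the Zariski closed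
  subgroups of the group of geometric points.
\<close>

definition geom_group :: "('n::finite, 'k::field) gl_poly set \<Rightarrow> ('n, 'k alg_closure) mat monoid"
  where "geom_group I = grp_points TR to_ac I"

definition zariski_closed :: "('n::finite, 'K::field) mat set \<Rightarrow> bool"
  where "zariski_closed S \<longleftrightarrow> (\<exists>J :: ('n, 'K) gl_poly set. S = carrier (grp_points TR id J))"

definition unipotent :: "('n::finite, 'K::field) mat \<Rightarrow> bool"
  where "unipotent g \<longleftrightarrow>
    (\<exists>m::nat. (\<lambda>i j. g i j - (if i = j then 1 else 0)) [^]\<^bsub>mat_monoid TR\<^esub> m = (\<lambda>i j. 0))"

definition connected_reductive :: "('n::finite, 'k::field) gl_poly set \<Rightarrow> bool"
  where "connected_reductive I \<longleftrightarrow>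
    algebraic_subgroup I \<and> smooth_group I \<and>
    connected_for zariski_closed (carrier (geom_group I)) \<and>
    (\<forall>U. U \<lhd> geom_group I \<longrightarrow> zariski_closed U \<longrightarrow> connected_for zariski_closed U \<longrightarrow>
       (\<forall>u\<in>U. unipotent u) \<longrightarrow> U = {\<one>\<^bsub>geom_group I\<^esub>})"

definition solvable_closed_connected ::
  "('n::finite, 'k::field) gl_poly set \<Rightarrow> ('n, 'k alg_closure) mat set \<Rightarrow> bool"
  where "solvable_closed_connected I S \<longleftrightarrow>
    subgroup S (geom_group I) \<and> zariski_closed S \<and> connected_for zariski_closed S \<and>
    solvable ((geom_group I)\<lparr>carrier := S\<rparr>)"

definition borel_subgroup ::
  "('n::finite, 'k::field) gl_poly set \<Rightarrow> ('n, 'k) gl_poly set \<Rightarrow> bool"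
  where "borel_subgroup B I \<longleftrightarrow>
    algebraic_subgroup_of B I \<and> smooth_group B \<and>
    solvable_closed_connected I (carrier (geom_group B)) \<and>
    (\<forall>S. solvable_closed_connected I S \<longrightarrow> carrier (geom_group B) \<subseteq> S \<longrightarrow>
       S = carrier (geom_group B))"

subsection \<open>Tori and cocharacters\<close>

text \<open>
  A homomorphism to \<open>GL\<^sub>n\<close> from the diagonalizable group with character group \<open>'c\<close>, as a matrix
  over the group algebra.  The three pushforwards are the entries evaluated at \<open>s\<close>, \<open>t\<close> and \<open>s t\<close>.
\<close>

definition diag_hom :: "('n::finite, 'c::ab_group_add \<Rightarrow>\<^sub>0 'k::field) mat \<Rightarrow> bool"
  where "diag_hom M \<longleftrightarrow> M \<in> carrier (GL TR) \<and>
    (\<forall>i j. (\<Sum>l\<in>UNIV. push (\<lambda>c. (c, 0)) (M i l) * push (\<lambda>c. (0, c)) (M l j)) =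
       push (\<lambda>c. (c, c)) (M i j))"

text \<open>
  A split torus is the image of a closed immersion \<open>M\<close> of a power \<open>r\<close> of the multiplicative group,
  whose coordinate ring is the group algebra of the free abelian group on \<open>{..<r}\<close>.
\<close>

definition split_torus :: "('n::finite, 'k::field) gl_poly set \<Rightarrow> bool"
  where "split_torus I \<longleftrightarrow> algebraic_subgroup I \<and>
    (\<exists>(r::nat) (M :: ('n, (nat \<Rightarrow>\<^sub>0 int) \<Rightarrow>\<^sub>0 'k) mat). diag_hom M \<and>
       range (mpoly_eval TR cst (gl_coords TR M)) =
         {p. \<forall>c\<in>Poly_Mapping.keys p. Poly_Mapping.keys c \<subseteq> {..<r}} \<and>
       I = {f. mpoly_eval TR cst (gl_coords TR M) f = 0})"

definition split_maximal_torus ::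
  "('n::finite, 'k::field) gl_poly set \<Rightarrow> ('n, 'k) gl_poly set \<Rightarrow> bool"
  where "split_maximal_torus T I \<longleftrightarrow>
    algebraic_subgroup_of T I \<and> split_torus T \<and>
    (\<forall>S. split_torus S \<longrightarrow> base_change I \<subseteq> S \<longrightarrow> S \<subseteq> base_change T \<longrightarrow> S = base_change T)"

definition cocharacter ::
  "('n::finite, 'k::field) gl_poly set \<Rightarrow> ('n, int \<Rightarrow>\<^sub>0 'k) mat \<Rightarrow> bool"
  where "cocharacter I \<mu> \<longleftrightarrow> diag_hom \<mu> \<and> \<mu> \<in> carrier (grp_points TR cst I)"

text \<open>Characters are represented by group-like functions, which matter only modulo the ideal.\<close>

definition character :: "('n::finite, 'k::field) gl_poly set \<Rightarrow> ('n, 'k) gl_poly \<Rightarrow> bool"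
  where "character I \<psi> \<longleftrightarrow> counit \<psi> = 1 \<and>
    comult \<psi> - left_factor \<psi> * right_factor \<psi> \<in> square_ideal I"

definition lie_algebra :: "('n::finite, 'k::field) gl_poly set \<Rightarrow> ('n, 'k) mat set"
  where "lie_algebra I =
    {Z. (\<lambda>i j. (if i = j then 1 else 0, Z i j)) \<in> carrier (grp_points dual_ring (\<lambda>c. (c, 0)) I)}"

text \<open>
  \<open>\<psi>\<close> occurs in the adjoint action of the torus \<open>T\<close> on \<open>V\<close>: there is a nonzero \<open>Z\<close> in \<open>V\<close> such that
  \<open>t Z t\<^sup>-\<^sup>1 = \<psi>(t) Z\<close> holds for the generic element \<open>t\<close> of \<open>T\<close>.
\<close>

definition adjoint_weight ::
  "('n::finite, 'k::field) gl_poly set \<Rightarrow> ('n, 'k) mat set \<Rightarrow> ('n, 'k) gl_poly \<Rightarrow> bool"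
  where "adjoint_weight T V \<psi> \<longleftrightarrow> character T \<psi> \<and>
    (\<exists>Z\<in>V. Z \<noteq> (\<lambda>i j. 0) \<and>
       (\<forall>i j. (\<Sum>l\<in>UNIV. \<Sum>m\<in>UNIV. var (Inl (i, l)) * cst (Z l m) * var (Inr (m, j)))
          - \<psi> * cst (Z i j) \<in> T))"

text \<open>
  The positive roots are the nontrivial weights of \<open>T\<close> on the Lie algebra of the Borel subgroup \<open>B\<close>,
  and the pairing of \<open>\<psi>\<close> with \<open>\<mu>\<close> is the exponent \<open>e\<close> with \<open>\<psi>(\<mu>(t)) = t\<^sup>e\<close>.
\<close>

definition dominant_cocharacter ::
  "('n::finite, 'k::field) gl_poly set \<Rightarrow> ('n, 'k) gl_poly set \<Rightarrow> ('n, int \<Rightarrow>\<^sub>0 'k) mat \<Rightarrow> bool"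
  where "dominant_cocharacter T B \<mu> \<longleftrightarrow> cocharacter T \<mu> \<and>
    (\<forall>\<psi>. adjoint_weight T (lie_algebra B) \<psi> \<longrightarrow> \<psi> - 1 \<notin> T \<longrightarrow>
       (\<exists>e\<ge>0. mpoly_eval TR cst (gl_coords TR \<mu>) \<psi> = Poly_Mapping.single e 1))"

definition cochar_eval ::
  "('r, 's) ring_scheme \<Rightarrow> ('k::zero \<Rightarrow> 'r) \<Rightarrow> ('n, int \<Rightarrow>\<^sub>0 'k) mat \<Rightarrow> 'r \<Rightarrow> ('n, 'r) mat"
  where "cochar_eval R \<phi> \<mu> u =
    (\<lambda>i j. \<Oplus>\<^bsub>R\<^esub>e\<in>Poly_Mapping.keys (\<mu> i j).
       \<phi> (Poly_Mapping.lookup (\<mu> i j) e) \<otimes>\<^bsub>R\<^esub> (u [^]\<^bsub>R\<^esub> e))"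

section \<open>Adelic groups and level structures\<close>

text \<open>Below, \<open>\<X>\<close> is the set of closed points and \<open>G\<close> the ideal of the group.\<close>

definition local_group ::
  "('k::field \<Rightarrow> 'f::field) \<Rightarrow> ('n::finite, 'k) gl_poly set \<Rightarrow> ('f \<Rightarrow> int)
     \<Rightarrow> ('n, (nat \<Rightarrow> 'f) set) mat monoid"
  where "local_group \<iota> G y = grp_points (completion y) (to_completion y \<circ> \<iota>) G"

definition integral_group ::
  "('k::field \<Rightarrow> 'f::field) \<Rightarrow> ('n::finite, 'k) gl_poly set \<Rightarrow> ('f \<Rightarrow> int)
     \<Rightarrow> ('n, (nat \<Rightarrow> 'f) set) mat monoid"
  where "integral_group \<iota> G y = grp_points (completed_local_ring y) (to_completion y \<circ> \<iota>) G"

text \<open>\<open>G(\<A>)\<close> is the restricted product of the groups \<open>G(F\<^sub>y)\<close> with respect to \<open>G(\<O>\<^sub>y)\<close>.\<close>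

definition adelic_group ::
  "('k::field \<Rightarrow> 'f::field) \<Rightarrow> ('f \<Rightarrow> int) set \<Rightarrow> ('n::finite, 'k) gl_poly set
     \<Rightarrow> (('f \<Rightarrow> int) \<Rightarrow> ('n, (nat \<Rightarrow> 'f) set) mat) monoid"
  where "adelic_group \<iota> \<X> G =
    (product_group \<X> (local_group \<iota> G))\<lparr>carrier :=
      {g \<in> carrier (product_group \<X> (local_group \<iota> G)).
         finite {y \<in> \<X>. g y \<notin> carrier (integral_group \<iota> G y)}}\<rparr>"

text \<open>The image of \<open>G(F)\<close> in \<open>G(\<A>)\<close>.\<close>

definition rational_points ::
  "('k::field \<Rightarrow> 'f::field) \<Rightarrow> ('f \<Rightarrow> int) set \<Rightarrow> ('n::finite, 'k) gl_poly set
     \<Rightarrow> (('f \<Rightarrow> int) \<Rightarrow> ('n, (nat \<Rightarrow> 'f) set) mat) set"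
  where "rational_points \<iota> \<X> G =
    (\<lambda>\<gamma>. \<lambda>y\<in>\<X>. \<lambda>i j. to_completion y (\<gamma> i j)) ` carrier (grp_points TR \<iota> G)"

definition effective_divisor :: "'p set \<Rightarrow> ('p \<Rightarrow> nat) \<Rightarrow> bool"
  where "effective_divisor \<X> D \<longleftrightarrow> finite {y \<in> \<X>. D y > 0}"

definition supp :: "'p set \<Rightarrow> ('p \<Rightarrow> nat) \<Rightarrow> 'p set"
  where "supp \<X> D = {y \<in> \<X>. D y > 0}"

definition ramification_datum ::
  "'p set \<Rightarrow> ('n::finite, 'k::field) gl_poly set \<Rightarrow> ('p \<Rightarrow> nat) \<Rightarrow> ('p \<Rightarrow> ('n, 'k) gl_poly set) \<Rightarrow> bool"
  where "ramification_datum \<X> G D H \<longleftrightarrow> (\<forall>y\<in>supp \<X> D. algebraic_subgroup_of (H y) G)"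

text \<open>The preimage in \<open>G(\<O>\<^sub>y)\<close> of \<open>H(\<O>\<^sub>y / p\<^sup>d)\<close>, for a uniformizer \<open>p\<close>.\<close>

definition congruence_preimage ::
  "('k::field \<Rightarrow> 'f::field) \<Rightarrow> ('n::finite, 'k) gl_poly set \<Rightarrow> ('f \<Rightarrow> int) \<Rightarrow> (nat \<Rightarrow> 'f) set
     \<Rightarrow> nat \<Rightarrow> ('n, 'k) gl_poly set \<Rightarrow> ('n, (nat \<Rightarrow> 'f) set) mat set"
  where "congruence_preimage \<iota> G y p d H =
    (let O\<^sub>y = completed_local_ring y;
         J = PIdl\<^bsub>O\<^sub>y\<^esub> (p [^]\<^bsub>O\<^sub>y\<^esub> d);
         red = (\<lambda>a. J +>\<^bsub>O\<^sub>y\<^esub> a)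
     in {g \<in> carrier (integral_group \<iota> G y).
           (\<lambda>i j. red (g i j)) \<in> carrier (grp_points (O\<^sub>y Quot J) (red \<circ> to_completion y \<circ> \<iota>) H)})"

definition level_group ::
  "('k::field \<Rightarrow> 'f::field) \<Rightarrow> ('f \<Rightarrow> int) set \<Rightarrow> (('f \<Rightarrow> int) \<Rightarrow> (nat \<Rightarrow> 'f) set)
     \<Rightarrow> ('n::finite, 'k) gl_poly set \<Rightarrow> (('f \<Rightarrow> int) \<Rightarrow> nat) \<Rightarrow> (('f \<Rightarrow> int) \<Rightarrow> ('n, 'k) gl_poly set)
     \<Rightarrow> (('f \<Rightarrow> int) \<Rightarrow> ('n, (nat \<Rightarrow> 'f) set) mat) set"
  where "level_group \<iota> \<X> \<pi> G D H =
    (\<Pi>\<^sub>E y\<in>\<X>. if y \<in> supp \<X> D then congruence_preimage \<iota> G y (\<pi> y) (D y) (H y)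
               else carrier (integral_group \<iota> G y))"

definition hecke_element ::
  "('k::field \<Rightarrow> 'f::field) \<Rightarrow> ('f \<Rightarrow> int) set \<Rightarrow> (('f \<Rightarrow> int) \<Rightarrow> (nat \<Rightarrow> 'f) set)
     \<Rightarrow> ('f \<Rightarrow> int) \<Rightarrow> ('n::finite, int \<Rightarrow>\<^sub>0 'k) mat \<Rightarrow> (('f \<Rightarrow> int) \<Rightarrow> ('n, (nat \<Rightarrow> 'f) set) mat)"
  where "hecke_element \<iota> \<X> \<pi> x \<mu> =
    (\<lambda>y\<in>\<X>. if y = x then cochar_eval (completion x) (to_completion x \<circ> \<iota>) \<mu> (\<pi> x)
            else \<one>\<^bsub>mat_monoid (completion y)\<^esub>)"

section \<open>Hecke graphs\<close>

definition double_coset :: "('a, 's) monoid_scheme \<Rightarrow> 'a set \<Rightarrow> 'a set \<Rightarrow> 'a \<Rightarrow> 'a set"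
  where "double_coset A \<Gamma> K g = (\<Gamma> #>\<^bsub>A\<^esub> g) <#>\<^bsub>A\<^esub> K"

text \<open>
  The edges out of a vertex are indexed by cosets only after the choice of a representative of the
  vertex; \<open>r\<close> is such a choice for all vertices.
\<close>

definition vertex_representatives ::
  "('a, 's) monoid_scheme \<Rightarrow> 'a set \<Rightarrow> 'a set \<Rightarrow> ('a set \<Rightarrow> 'a) \<Rightarrow> bool"
  where "vertex_representatives A \<Gamma> K r \<longleftrightarrow>
    (\<forall>v \<in> double_coset A \<Gamma> K ` carrier A. r v \<in> carrier A \<and> double_coset A \<Gamma> K (r v) = v)"

text \<open>
  The arc \<open>(v, E)\<close> is the edge \<open>E = \<sigma> K\<close> out of \<open>v\<close>.  Its head is written as the product set
  \<open>\<Gamma> (r v) E\<close>, which is the double coset of \<open>(r v) \<sigma>\<close> for every \<open>\<sigma>\<close> in \<open>E\<close>.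
\<close>

definition hecke_digraph ::
  "('a, 's) monoid_scheme \<Rightarrow> 'a set \<Rightarrow> 'a set \<Rightarrow> 'a \<Rightarrow> ('a set \<Rightarrow> 'a) \<Rightarrow> ('a set, 'a set \<times> 'a set) pre_digraph"
  where "hecke_digraph A \<Gamma> K \<Delta> r =
    \<lparr>verts = double_coset A \<Gamma> K ` carrier A,
     arcs = {(v, E). v \<in> double_coset A \<Gamma> K ` carrier A \<and>
                     E \<in> (\<lambda>\<sigma>. \<sigma> <#\<^bsub>A\<^esub> K) ` double_coset A K K \<Delta>},
     tail = fst,
     head = (\<lambda>(v, E). (\<Gamma> #>\<^bsub>A\<^esub> r v) <#>\<^bsub>A\<^esub> E)\<rparr>"

text \<open>
  The map \<open>\<Gamma> \ A / K\<^sub>1 \<rightarrow> \<Gamma> \ A / K\<^sub>2\<close> for \<open>K\<^sub>1 \<subseteq> K\<^sub>2\<close>, sending \<open>\<Gamma> g K\<^sub>1\<close> to \<open>\<Gamma> g K\<^sub>1 K\<^sub>2 = \<Gamma> g K\<^sub>2\<close>.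
\<close>

definition vertex_map :: "('a, 's) monoid_scheme \<Rightarrow> 'a set \<Rightarrow> 'a set \<Rightarrow> 'a set"
  where "vertex_map A K\<^sub>2 v = v <#>\<^bsub>A\<^esub> K\<^sub>2"

text \<open>
  The map on edges out of a vertex \<open>\<tilde>a\<close> over \<open>a\<close>.  If both vertices have the same representative
  (\<open>\<kappa> = 1\<close>) it sends \<open>\<sigma> K\<^sub>1\<close> to \<open>\<sigma> K\<^sub>2\<close>; if they have the representatives \<open>\<gamma> h \<kappa>\<close> and \<open>h\<close>, the
  edge \<open>\<sigma> K\<^sub>2\<close> based at \<open>\<gamma> h \<kappa>\<close> is the edge \<open>\<kappa> \<sigma> K\<^sub>2\<close> based at \<open>h\<close>.
\<close>

definition edge_map ::
  "('a, 's) monoid_scheme \<Rightarrow> 'a set \<Rightarrow> 'a set \<Rightarrow> 'a \<Rightarrow> 'a set \<times> 'a set \<Rightarrow> 'a set \<times> 'a set"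
  where "edge_map A K\<^sub>2 a \<kappa> = (\<lambda>(v, E). (a, (\<kappa> <#\<^bsub>A\<^esub> E) <#>\<^bsub>A\<^esub> K\<^sub>2))"

end

(*
  Write K for the level groups.  The edges out of a vertex are the cosets k Delta K with k in K.
  Every element of K_2 is a product of its component at x, which lies in K_1 because the two
  ramification data agree at x, and a component away from x, which commutes with Delta.  Hence
  K_2 Delta K_2 = K_1 Delta K_2, so that k Delta K_1 -> k Delta K_2 is surjective.  It is injective
  because an element kappa of K_2 with k Delta = k' Delta kappa lies in K_1: away from x it equals
  k'^(-1) k, and at x there is nothing to show.

  Everything takes place in the full product of the groups G(F_y), of which G(A) is used only as a
  subset.  This avoids the finiteness of the set of poles of a rational function, which would be
  needed for G(F) to lie in G(A).  What has to be checked is that K_1, K_2 and G(F) are subgroups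
  (points of a Hopf ideal form a group, functorially in the ring) and that mu(pi_x) is a point of G
  over the completion (a uniformizer is invertible there).
*)

theory Submission
  imports Defs
begin

text \<open>Two kinds of ring meet here: polynomials and group algebras live in type classes, while
  the completion, \<open>O\<^sub>v\<close> and its quotients are rings with explicit carriers. All
  evaluations are therefore drawn from one universal property: a scalar map and a monoid map into a
  commutative ring extend to a ring homomorphism on the monoid algebra. For monomials this is
  evaluation at a point, and each Hopf ideal condition becomes a closure property of the points; for
  the monoid \<open>int\<close> it substitutes a unit for t, which makes mu(pi_x) a point of the
  torus. A uniformizer is given only as generator of a maximal ideal. Its invertibility comes from
  two facts: the completed local ring is not a field, so the generator is nonzero, and the
  completion is a field. Representatives of vertices are chosen independently in the two graphs. The
  representative of a lift differs from that of its image by some \<gamma> on the left and some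
  \<kappa> on the right. The first is absorbed by the double cosets; the second has to be built into
  the map on edges.\<close>

lemma TR_simps [simp]:
  "carrier (TR :: 'a::comm_ring_1 ring) = UNIV"
  "a \<otimes>\<^bsub>(TR :: 'a ring)\<^esub> b = a * b"
  "a \<oplus>\<^bsub>(TR :: 'a ring)\<^esub> b = a + b"
  "\<one>\<^bsub>(TR :: 'a ring)\<^esub> = 1"
  "\<zero>\<^bsub>(TR :: 'a ring)\<^esub> = 0"
  by (simp_all add: ring_of_type_algebra_def)

lemma TR_cring: "cring (TR :: 'a::comm_ring_1 ring)"
  by (rule cring_from_type_algebra)

text \<open>Bridge from type class sums to \<open>finsum\<close>. For infinite \<open>S\<close> both
  sums default to zero, so the induction covers that case too.\<close>

lemma TR_hom_sum:
  assumes "cring R" and h: "h \<in> ring_hom (TR :: 'a::comm_ring_1 ring) R"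
  shows "h (sum f S) = (\<Oplus>\<^bsub>R\<^esub>i\<in>S. h (f i))"
proof -
  interpret ring_hom_cring "TR :: 'a ring" R h
    using assms TR_cring by (intro ring_hom_cring.intro ring_hom_cring_axioms.intro)
  have closed: "h a \<in> carrier R" for a
    using hom_closed by simp
  have zero: "h 0 = \<zero>\<^bsub>R\<^esub>" and add: "h (a + b) = h a \<oplus>\<^bsub>R\<^esub> h b" for a b
    using hom_zero hom_add[of a b] by simp_all
  show ?thesis
    by (induction S rule: infinite_finite_induct) (simp_all add: zero add closed Pi_def)
qed

lemma to_ac_hom: "to_ac \<in> ring_hom (TR :: 'k::field ring) TR"
  by (auto intro: ring_hom_memI)

section \<open>Evaluation of monoid algebras\<close>

lemma poly_mapping_add_single_induct [case_names zero add_single]: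
  fixes p :: "'m \<Rightarrow>\<^sub>0 'k::comm_monoid_add"
  assumes "P 0" and step: "\<And>q m c. P q \<Longrightarrow> P (q + Poly_Mapping.single m c)"
  shows "P p"
proof (induction p rule: update_induct)
  case const
  show ?case by fact
next
  case (update q m c)
  \<comment> \<open>\<open>m\<close> is not a key of \<open>q\<close>, so overwriting its
    coefficient 0 is the same as adding a term.\<close>
  have "Poly_Mapping.update m c q = q + Poly_Mapping.single m c"
    using update(1)
    by (intro poly_mapping_eqI) (auto simp: lookup_update lookup_add lookup_single in_keys_iff)
  then show ?case using step update by simp
qed

text \<open>The linear extension of \<open>\<theta>\<close> to the monoid algebra. Leaving the
  monomials abstract lets one development serve both polynomials and Laurent polynomials.\<close>

definition alg_eval ::
  "('r, 's) ring_scheme \<Rightarrow> ('k::zero \<Rightarrow> 'r) \<Rightarrow> ('m \<Rightarrow> 'r) \<Rightarrow> ('m \<Rightarrow>\<^sub>0 'k) \<Rightarrow> 'r"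
  where "alg_eval R \<phi> \<theta> p =
    (\<Oplus>\<^bsub>R\<^esub>m\<in>Poly_Mapping.keys p. \<phi> (Poly_Mapping.lookup p m) \<otimes>\<^bsub>R\<^esub> \<theta> m)"

locale monoid_algebra_eval = cring R for R (structure) +
  fixes \<phi> :: "'k::comm_ring_1 \<Rightarrow> 'a" and \<theta> :: "'m::cancel_comm_monoid_add \<Rightarrow> 'a"
  assumes scalars: "\<phi> \<in> ring_hom TR R"
    and char_closed [simp]: "\<theta> m \<in> carrier R"
    and char_zero [simp]: "\<theta> 0 = \<one>"
    and char_add: "\<theta> (m + n) = \<theta> m \<otimes> \<theta> n"
begin

lemma scalar_simps [simp]:
  "\<phi> c \<in> carrier R" "\<phi> 0 = \<zero>" "\<phi> 1 = \<one>"
  "\<phi> (c + d) = \<phi> c \<oplus> \<phi> d" "\<phi> (c * d) = \<phi> c \<otimes> \<phi> d"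
  using ring_hom_memE[OF scalars] ring_hom_zero[OF scalars cring.axioms(1)[OF TR_cring] ring_axioms]
  by simp_all

text \<open>Cancellation can shrink the key set of a sum, so evaluations are compared over a common
  finite superset, padded with zero coefficients.\<close>

lemma alg_eval_superset:
  assumes "finite S" "Poly_Mapping.keys p \<subseteq> S"
  shows "alg_eval R \<phi> \<theta> p = (\<Oplus>m\<in>S. \<phi> (Poly_Mapping.lookup p m) \<otimes> \<theta> m)"
  unfolding alg_eval_def
  by (rule add.finprod_mono_neutral_cong_left) (use assms in \<open>auto simp: in_keys_iff\<close>)

lemma alg_eval_closed [simp]: "alg_eval R \<phi> \<theta> p \<in> carrier R"
  unfolding alg_eval_def by (rule finsum_closed) auto

lemma alg_eval_add: "alg_eval R \<phi> \<theta> (p + q) = alg_eval R \<phi> \<theta> p \<oplus> alg_eval R \<phi> \<theta> q"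
proof -
  let ?S = "Poly_Mapping.keys p \<union> Poly_Mapping.keys q"
  have "alg_eval R \<phi> \<theta> (p + q) = (\<Oplus>m\<in>?S. \<phi> (Poly_Mapping.lookup (p + q) m) \<otimes> \<theta> m)"
    by (rule alg_eval_superset) (simp_all add: keys_add)
  also have "\<dots> = (\<Oplus>m\<in>?S. \<phi> (Poly_Mapping.lookup p m) \<otimes> \<theta> m \<oplus> \<phi> (Poly_Mapping.lookup q m) \<otimes> \<theta> m)"
    by (simp add: lookup_add l_distr)
  also have "\<dots> = alg_eval R \<phi> \<theta> p \<oplus> alg_eval R \<phi> \<theta> q"
    by (subst finsum_addf) (auto simp: alg_eval_superset[of ?S])
  finally show ?thesis .
qed

lemma alg_eval_single: "alg_eval R \<phi> \<theta> (Poly_Mapping.single m c) = \<phi> c \<otimes> \<theta> m"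
  by (simp add: alg_eval_superset[of "{m}"])

lemma alg_eval_zero [simp]: "alg_eval R \<phi> \<theta> 0 = \<zero>"
  by (simp add: alg_eval_def)

text \<open>Both sides are biadditive, so an induction on each factor reduces the claim to two
  single terms, where it is \<open>char_add\<close> and commutativity.\<close>

lemma alg_eval_mult: "alg_eval R \<phi> \<theta> (p * q) = alg_eval R \<phi> \<theta> p \<otimes> alg_eval R \<phi> \<theta> q"
proof (induction p rule: poly_mapping_add_single_induct)
  case zero
  then show ?case by simp
next
  case (add_single p m c)
  have "alg_eval R \<phi> \<theta> (Poly_Mapping.single m c * q) =
      alg_eval R \<phi> \<theta> (Poly_Mapping.single m c) \<otimes> alg_eval R \<phi> \<theta> q"
  proof (induction q rule: poly_mapping_add_single_induct)
    case zero
    then show ?case by simp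
  next
    case (add_single q n d)
    then show ?case
      by (simp add: distrib_left alg_eval_add mult_single alg_eval_single char_add r_distr m_ac)
  qed
  with add_single show ?case by (simp add: distrib_right alg_eval_add l_distr)
qed

lemma alg_eval_hom: "alg_eval R \<phi> \<theta> \<in> ring_hom TR R"
proof (rule ring_hom_memI)
  show "alg_eval R \<phi> \<theta> \<one>\<^bsub>TR\<^esub> = \<one>"
    using alg_eval_single[of 0 1] by simp
qed (simp_all add: alg_eval_add alg_eval_mult)

end

definition monomial_eval :: "('r, 's) ring_scheme \<Rightarrow> ('v \<Rightarrow> 'r) \<Rightarrow> ('v \<Rightarrow>\<^sub>0 nat) \<Rightarrow> 'r"
  where "monomial_eval R a m =
    (\<Otimes>\<^bsub>R\<^esub>v\<in>Poly_Mapping.keys m. a v [^]\<^bsub>R\<^esub> Poly_Mapping.lookup m v)"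

lemma mpoly_eval_alg_eval: "mpoly_eval R \<phi> a = alg_eval R \<phi> (monomial_eval R a)"
  by (simp add: mpoly_eval_def alg_eval_def monomial_eval_def fun_eq_iff)

context cring
begin

lemma monomial_eval_superset:
  assumes "\<And>v. a v \<in> carrier R" "finite S" "Poly_Mapping.keys m \<subseteq> S"
  shows "monomial_eval R a m = (\<Otimes>v\<in>S. a v [^] Poly_Mapping.lookup m v)"
  unfolding monomial_eval_def
  by (rule finprod_mono_neutral_cong_left) (use assms in \<open>auto simp: in_keys_iff\<close>)

text \<open>Exponents add when monomials are multiplied; this makes polynomials an instance of the
  universal property.\<close>

lemma monoid_algebra_eval_monomial:
  assumes "\<phi> \<in> ring_hom TR R" and a: "\<And>v. a v \<in> carrier R"
  shows "monoid_algebra_eval R \<phi> (monomial_eval R a)"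
proof unfold_locales
  show "\<phi> \<in> ring_hom TR R" by fact
  show "monomial_eval R a m \<in> carrier R" for m
    unfolding monomial_eval_def using a by (intro finprod_closed) auto
  show "monomial_eval R a 0 = \<one>"
    by (simp add: monomial_eval_def)
  show "monomial_eval R a (m + n) = monomial_eval R a m \<otimes> monomial_eval R a n" for m n
  proof -
    let ?S = "Poly_Mapping.keys m \<union> Poly_Mapping.keys n"
    have "monomial_eval R a (m + n) = (\<Otimes>v\<in>?S. a v [^] Poly_Mapping.lookup (m + n) v)"
      by (rule monomial_eval_superset) (simp_all add: a keys_add)
    also have "\<dots> = (\<Otimes>v\<in>?S. a v [^] Poly_Mapping.lookup m v \<otimes> a v [^] Poly_Mapping.lookup n v)"
      by (simp add: lookup_add nat_pow_mult a)
    also have "\<dots> = monomial_eval R a m \<otimes> monomial_eval R a n"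
      by (subst finprod_multf) (auto simp: monomial_eval_superset[of a ?S] a)
    finally show ?thesis .
  qed
qed

lemma mpoly_eval_hom:
  assumes "\<phi> \<in> ring_hom TR R" "\<And>v. a v \<in> carrier R"
  shows "mpoly_eval R \<phi> a \<in> ring_hom TR R"
  unfolding mpoly_eval_alg_eval
  by (rule monoid_algebra_eval.alg_eval_hom[OF monoid_algebra_eval_monomial[OF assms]])

lemma mpoly_eval_cst:
  assumes "\<phi> \<in> ring_hom TR R" "\<And>v. a v \<in> carrier R"
  shows "mpoly_eval R \<phi> a (cst c) = \<phi> c"
proof -
  interpret monoid_algebra_eval R \<phi> "monomial_eval R a"
    by (rule monoid_algebra_eval_monomial[OF assms])
  show ?thesis by (simp add: mpoly_eval_alg_eval alg_eval_single)
qed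

lemma mpoly_eval_var:
  assumes "\<phi> \<in> ring_hom TR R" "\<And>v. a v \<in> carrier R"
  shows "mpoly_eval R \<phi> a (var v) = a v"
proof -
  interpret monoid_algebra_eval R \<phi> "monomial_eval R a"
    by (rule monoid_algebra_eval_monomial[OF assms])
  have "mpoly_eval R \<phi> a (var v) = monomial_eval R a (Poly_Mapping.single v 1)"
    by (simp add: mpoly_eval_alg_eval alg_eval_single)
  also have "\<dots> = a v"
    using assms(2) by (simp add: monomial_eval_superset[of a "{v}"])
  finally show ?thesis .
qed

end

text \<open>Homomorphisms commute with finite sums, products and powers. With a polynomial ring for
  \<open>R\<close> and \<open>cst\<close> for \<open>\<phi>\<close>, this says that substituting and
  then evaluating is evaluating at the substituted point, which is how \<open>antipode\<close> and
  \<open>comult\<close> are compared with operations on points.\<close>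

lemma ring_hom_mpoly_eval:
  assumes R: "cring R" and S: "cring S" and h: "h \<in> ring_hom R S"
    and \<phi>: "\<phi> \<in> ring_hom TR R" and a: "\<And>v :: 'v. a v \<in> carrier R"
  shows "h (mpoly_eval R \<phi> a p) = mpoly_eval S (h \<circ> \<phi>) (h \<circ> a) p"
proof -
  interpret ring_hom_cring R S h
    using R S h by (intro ring_hom_cring.intro ring_hom_cring_axioms.intro)
  have \<phi>_closed: "\<phi> c \<in> carrier R" for c
    using ring_hom_closed[OF \<phi>] by simp
  have pow: "h (b [^]\<^bsub>R\<^esub> n) = h b [^]\<^bsub>S\<^esub> n" if "b \<in> carrier R" for b and n :: nat
    using that by (induction n) simp_all
  have mon_closed: "(\<Otimes>\<^bsub>R\<^esub>v\<in>Poly_Mapping.keys m. a v [^]\<^bsub>R\<^esub> Poly_Mapping.lookup m v) \<in> carrier R"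
    for m :: "'v \<Rightarrow>\<^sub>0 nat"
    using a by (intro R.finprod_closed) auto
  have mon: "h (\<Otimes>\<^bsub>R\<^esub>v\<in>Poly_Mapping.keys m. a v [^]\<^bsub>R\<^esub> Poly_Mapping.lookup m v) =
      (\<Otimes>\<^bsub>S\<^esub>v\<in>Poly_Mapping.keys m. (h \<circ> a) v [^]\<^bsub>S\<^esub> Poly_Mapping.lookup m v)"
    for m :: "'v \<Rightarrow>\<^sub>0 nat"
    using a by (subst hom_finprod) (auto simp: pow comp_def)
  show ?thesis
    unfolding mpoly_eval_def
    by (subst hom_finsum) (use \<phi>_closed mon_closed in \<open>auto simp: mon comp_def[of h]\<close>)
qed

lemma cst_hom: "(cst :: 'k::comm_ring_1 \<Rightarrow> 'm::cancel_comm_monoid_add \<Rightarrow>\<^sub>0 'k) \<in> ring_hom TR TR"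
  by (rule ring_hom_memI) (simp_all add: single_add mult_single)

lemma TR_hom_genideal_zero:
  assumes R: "cring R" and h: "h \<in> ring_hom (TR :: 'a::comm_ring_1 ring) R"
    and S: "\<And>a. a \<in> S \<Longrightarrow> h a = \<zero>\<^bsub>R\<^esub>" and p: "p \<in> Idl\<^bsub>TR\<^esub> S"
  shows "h p = \<zero>\<^bsub>R\<^esub>"
proof -
  have "ideal (a_kernel TR R h) TR"
    by (rule ring_hom_ring.kernel_is_ideal[OF ring_hom_ringI2])
      (fact cring.axioms(1)[OF TR_cring] cring.axioms(1)[OF R] h)+
  moreover have "a_kernel TR R h = {a. h a = \<zero>\<^bsub>R\<^esub>}"
    by (simp add: a_kernel_def')
  ultimately have "Idl\<^bsub>TR\<^esub> S \<subseteq> {a. h a = \<zero>\<^bsub>R\<^esub>}"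
    using S by (intro ring.genideal_minimal[OF cring.axioms(1)[OF TR_cring]]) auto
  then show ?thesis using p by blast
qed

section \<open>Matrix groups\<close>

lemma (in abelian_monoid) finsum_swap:
  assumes "finite S" "finite T" "\<And>i j. i \<in> S \<Longrightarrow> j \<in> T \<Longrightarrow> f i j \<in> carrier G"
  shows "(\<Oplus>i\<in>S. \<Oplus>j\<in>T. f i j) = (\<Oplus>j\<in>T. \<Oplus>i\<in>S. f i j)"
  using assms(1,3)
proof (induction S)
  case empty
  then show ?case by simp
next
  case (insert a S)
  then have "(\<Oplus>i\<in>insert a S. \<Oplus>j\<in>T. f i j) = (\<Oplus>j\<in>T. f a j) \<oplus> (\<Oplus>j\<in>T. \<Oplus>i\<in>S. f i j)"
    by (simp add: Pi_def)
  also have "\<dots> = (\<Oplus>j\<in>T. f a j \<oplus> (\<Oplus>i\<in>S. f i j))"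
    using insert by (intro finsum_addf[symmetric]) auto
  also have "\<dots> = (\<Oplus>j\<in>T. \<Oplus>i\<in>insert a S. f i j)"
    using insert by (intro finsum_cong') auto
  finally show ?case .
qed

context cring
begin

lemma mat_monoid_simps:
  "g \<in> carrier (mat_monoid R) \<longleftrightarrow> (\<forall>i j. g i j \<in> carrier R)"
  "(g \<otimes>\<^bsub>mat_monoid R\<^esub> h) i j = (\<Oplus>l\<in>UNIV. g i l \<otimes> h l j)"
  "\<one>\<^bsub>mat_monoid R\<^esub> i j = (if i = j then \<one> else \<zero>)"
  by (simp_all add: mat_monoid_def)

lemma monoid_mat_monoid: "Group.monoid (mat_monoid R :: ('n::finite, 'a) mat monoid)"
proof (rule monoidI)
  fix f g h :: "('n, 'a) mat"
  assume *: "f \<in> carrier (mat_monoid R)" "g \<in> carrier (mat_monoid R)" "h \<in> carrier (mat_monoid R)"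
  note [simp] = *[unfolded mat_monoid_simps, rule_format]
  show "f \<otimes>\<^bsub>mat_monoid R\<^esub> g \<otimes>\<^bsub>mat_monoid R\<^esub> h = f \<otimes>\<^bsub>mat_monoid R\<^esub> (g \<otimes>\<^bsub>mat_monoid R\<^esub> h)"
  proof (intro ext)
    fix i j
    have "(\<Oplus>l\<in>UNIV. (\<Oplus>k\<in>UNIV. f i k \<otimes> g k l) \<otimes> h l j) =
        (\<Oplus>l\<in>UNIV. \<Oplus>k\<in>UNIV. f i k \<otimes> (g k l \<otimes> h l j))"
      by (simp add: finsum_ldistr m_assoc Pi_def)
    also have "\<dots> = (\<Oplus>k\<in>UNIV. \<Oplus>l\<in>UNIV. f i k \<otimes> (g k l \<otimes> h l j))"
      by (rule finsum_swap) auto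
    also have "\<dots> = (\<Oplus>k\<in>UNIV. f i k \<otimes> (\<Oplus>l\<in>UNIV. g k l \<otimes> h l j))"
      by (simp add: finsum_rdistr Pi_def)
    finally show "(f \<otimes>\<^bsub>mat_monoid R\<^esub> g \<otimes>\<^bsub>mat_monoid R\<^esub> h) i j =
        (f \<otimes>\<^bsub>mat_monoid R\<^esub> (g \<otimes>\<^bsub>mat_monoid R\<^esub> h)) i j"
      by (simp add: mat_monoid_simps)
  qed
next
  fix g :: "('n, 'a) mat"
  assume *: "g \<in> carrier (mat_monoid R)"
  note [simp] = *[unfolded mat_monoid_simps, rule_format]
  have "(\<Oplus>l\<in>UNIV. (if i = l then \<one> else \<zero>) \<otimes> g l j) = (\<Oplus>l\<in>UNIV. if i = l then g l j else \<zero>)" for i j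
    by (rule finsum_cong') auto
  then show "\<one>\<^bsub>mat_monoid R\<^esub> \<otimes>\<^bsub>mat_monoid R\<^esub> g = g"
    by (intro ext) (simp add: mat_monoid_simps finsum_singleton Pi_def)
  \<comment> \<open>The test is turned round to \<open>j = l\<close>, the shape in which
    \<open>finsum_singleton\<close> collapses the sum.\<close>
  have "(\<Oplus>l\<in>UNIV. g i l \<otimes> (if l = j then \<one> else \<zero>)) = (\<Oplus>l\<in>UNIV. if j = l then g i l else \<zero>)" for i j
    by (rule finsum_cong') auto
  then show "g \<otimes>\<^bsub>mat_monoid R\<^esub> \<one>\<^bsub>mat_monoid R\<^esub> = g"
    by (intro ext) (simp add: mat_monoid_simps finsum_singleton Pi_def)
qed (auto simp: mat_monoid_simps)

lemma group_GL: "group (GL R :: ('n::finite, 'a) mat monoid)"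
  unfolding GL_def by (rule monoid.units_group[OF monoid_mat_monoid])

lemma GL_carrierD:
  fixes g :: "('n::finite, 'a) mat"
  assumes "g \<in> carrier (GL R)"
  shows "g \<in> carrier (mat_monoid R)" "inv\<^bsub>mat_monoid R\<^esub> g \<in> carrier (mat_monoid R)"
    "g \<otimes>\<^bsub>mat_monoid R\<^esub> inv\<^bsub>mat_monoid R\<^esub> g = \<one>\<^bsub>mat_monoid R\<^esub>"
    "inv\<^bsub>mat_monoid R\<^esub> g \<otimes>\<^bsub>mat_monoid R\<^esub> g = \<one>\<^bsub>mat_monoid R\<^esub>"
  using assms monoid.Units_closed[OF monoid_mat_monoid] monoid.Units_inv_closed[OF monoid_mat_monoid]
    monoid.Units_r_inv[OF monoid_mat_monoid] monoid.Units_l_inv[OF monoid_mat_monoid]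
  by (auto simp: GL_def units_of_carrier)

lemma GL_inv:
  fixes g :: "('n::finite, 'a) mat"
  assumes "g \<in> carrier (GL R)"
  shows "inv\<^bsub>GL R\<^esub> g = inv\<^bsub>mat_monoid R\<^esub> g"
  using assms monoid.units_of_inv[OF monoid_mat_monoid] by (simp add: GL_def units_of_carrier)

lemma gl_coords_closed:
  fixes g :: "('n::finite, 'a) mat"
  assumes "g \<in> carrier (GL R)"
  shows "gl_coords R g v \<in> carrier R"
  using GL_carrierD(1,2)[OF assms] by (cases v) (auto simp: gl_coords_def mat_monoid_simps)

end

lemma GL_mult: "g \<otimes>\<^bsub>GL R\<^esub> h = g \<otimes>\<^bsub>mat_monoid R\<^esub> h"
  and GL_one: "\<one>\<^bsub>GL R\<^esub> = \<one>\<^bsub>mat_monoid R\<^esub>"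
  by (simp_all add: GL_def units_of_mult units_of_one)

lemma grp_points_simps:
  "g \<otimes>\<^bsub>grp_points R \<phi> I\<^esub> h = g \<otimes>\<^bsub>mat_monoid R\<^esub> h"
  "\<one>\<^bsub>grp_points R \<phi> I\<^esub> = \<one>\<^bsub>mat_monoid R\<^esub>"
  "carrier (grp_points R \<phi> I) =
     {g \<in> carrier (GL R). \<forall>f\<in>I. mpoly_eval R \<phi> (gl_coords R g) f = \<zero>\<^bsub>R\<^esub>}"
  by (simp_all add: grp_points_def GL_mult GL_one)

subsection \<open>Functoriality\<close>

locale mat_ring_hom = ring_hom_cring
begin

lemma mat_map_mult:
  assumes "f \<in> carrier (mat_monoid R)" "g \<in> carrier (mat_monoid R)"
  shows "(\<lambda>i j. h ((f \<otimes>\<^bsub>mat_monoid R\<^esub> g) i j)) =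
    (\<lambda>i j. h (f i j)) \<otimes>\<^bsub>mat_monoid S\<^esub> (\<lambda>i j. h (g i j))"
  using assms by (intro ext) (simp add: R.mat_monoid_simps S.mat_monoid_simps Pi_def comp_def)

lemma mat_map_one: "(\<lambda>i j. h (\<one>\<^bsub>mat_monoid R\<^esub> i j)) = \<one>\<^bsub>mat_monoid S\<^esub>"
  by (intro ext) (simp add: R.mat_monoid_simps S.mat_monoid_simps)

lemma mat_map_closed:
  "g \<in> carrier (mat_monoid R) \<Longrightarrow> (\<lambda>i j. h (g i j)) \<in> carrier (mat_monoid S)"
  by (simp add: R.mat_monoid_simps S.mat_monoid_simps)

text \<open>The image of the inverse is an inverse of the image. The second claim matters because
  half of the coordinates of a point are entries of its inverse.\<close>

lemma GL_map:
  fixes g :: "('n::finite, 'a) mat"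
  assumes g: "g \<in> carrier (GL R)"
  shows "(\<lambda>i j. h (g i j)) \<in> carrier (GL S)"
    and "inv\<^bsub>mat_monoid S\<^esub> (\<lambda>i j. h (g i j)) = (\<lambda>i j. h ((inv\<^bsub>mat_monoid R\<^esub> g) i j))"
proof -
  note g' = R.GL_carrierD[OF g]
  let ?h = "\<lambda>g :: ('n, 'a) mat. \<lambda>i j. h (g i j)"
  have *: "?h g \<otimes>\<^bsub>mat_monoid S\<^esub> ?h (inv\<^bsub>mat_monoid R\<^esub> g) = \<one>\<^bsub>mat_monoid S\<^esub>"
    "?h (inv\<^bsub>mat_monoid R\<^esub> g) \<otimes>\<^bsub>mat_monoid S\<^esub> ?h g = \<one>\<^bsub>mat_monoid S\<^esub>"
    using g' by (simp_all flip: mat_map_mult mat_map_one)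
  show "?h g \<in> carrier (GL S)"
    using * mat_map_closed g'(1,2) by (auto simp: GL_def units_of_carrier Units_def)
  show "inv\<^bsub>mat_monoid S\<^esub> (?h g) = ?h (inv\<^bsub>mat_monoid R\<^esub> g)"
    using * mat_map_closed g'(1,2) by (intro monoid.inv_char[OF S.monoid_mat_monoid]) auto
qed

lemma gl_coords_map:
  fixes g :: "('n::finite, 'a) mat"
  assumes "g \<in> carrier (GL R)"
  shows "gl_coords S (\<lambda>i j. h (g i j)) = h \<circ> gl_coords R g"
  by (auto simp: gl_coords_def GL_map(2)[OF assms] fun_eq_iff split: sum.splits)

text \<open>The equations have coefficients in \<open>'k\<close>, so the value of an equation at the
  image point is the image under \<open>h\<close> of its value at \<open>g\<close>, which is
  zero.\<close>

lemma grp_points_map: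
  fixes g :: "('n::finite, 'a) mat"
  assumes \<phi>: "\<phi> \<in> ring_hom TR R" and g: "g \<in> carrier (grp_points R \<phi> I)"
  shows "(\<lambda>i j. h (g i j)) \<in> carrier (grp_points S (h \<circ> \<phi>) I)"
proof -
  have gGL: "g \<in> carrier (GL R)"
    using g by (simp add: grp_points_simps)
  have "mpoly_eval S (h \<circ> \<phi>) (h \<circ> gl_coords R g) f = h (mpoly_eval R \<phi> (gl_coords R g) f)" for f
    by (rule ring_hom_mpoly_eval[symmetric])
      (use R.is_cring S.is_cring \<phi> R.gl_coords_closed[OF gGL] in auto)
  then show ?thesis
    using g GL_map(1)[OF gGL] by (simp add: grp_points_simps gl_coords_map[OF gGL])
qed

end

subsection \<open>Closed subgroup schemes have groups of points\<close>

context cring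
begin

lemma gl_coords_one:
  "gl_coords R (\<one>\<^bsub>mat_monoid R\<^esub> :: ('n::finite, 'a) mat) =
    case_sum (\<lambda>(i, j). if i = j then \<one> else \<zero>) (\<lambda>(i, j). if i = j then \<one> else \<zero>)"
  by (auto simp: gl_coords_def mat_monoid_simps monoid.inv_one[OF monoid_mat_monoid] fun_eq_iff
      split: sum.splits)

text \<open>Each Hopf ideal axiom gives one closure property: \<open>counit\<close> the identity,
  \<open>antipode\<close> inverses, \<open>comult\<close> products. In each case the value of
  \<open>f\<close> at the new point is the value of a transformed polynomial at the old ones, and
  the axiom makes it vanish.\<close>

lemma subgroup_grp_points:
  fixes I :: "('n::finite, 'k::field) gl_poly set"
  assumes I: "algebraic_subgroup I" and \<phi>: "\<phi> \<in> ring_hom TR R"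
  shows "subgroup (carrier (grp_points R \<phi> I)) (GL R)"
proof (rule group.subgroupI[OF group_GL])
  show "carrier (grp_points R \<phi> I) \<subseteq> carrier (GL R)"
    by (auto simp: grp_points_simps)
next
  let ?e = "case_sum (\<lambda>(i, j). if i = j then 1 else 0) (\<lambda>(i, j). if i = j then 1 else 0)
    :: 'n gl_var \<Rightarrow> 'k"
  interpret \<phi>: ring_hom_cring TR R \<phi>
    using TR_cring \<phi> is_cring by (intro ring_hom_cring.intro ring_hom_cring_axioms.intro)
  have "mpoly_eval R \<phi> (gl_coords R \<one>\<^bsub>mat_monoid R\<^esub>) f = \<zero>" if "f \<in> I" for f
  proof -
    \<comment> \<open>The coordinates of the unit matrix are images of the scalars 0 and 1, so the
      evaluation already takes place over \<open>'k\<close>, where it is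
      \<open>counit\<close>.\<close>
    have "gl_coords R \<one>\<^bsub>mat_monoid R\<^esub> = \<phi> \<circ> ?e"
      using \<phi>.hom_one \<phi>.hom_zero by (auto simp: gl_coords_one fun_eq_iff split: sum.splits)
    then have "mpoly_eval R \<phi> (gl_coords R \<one>\<^bsub>mat_monoid R\<^esub>) f = mpoly_eval R (\<phi> \<circ> id) (\<phi> \<circ> ?e) f"
      by simp
    also have "\<dots> = \<phi> (counit f)"
      unfolding counit_def
      by (rule ring_hom_mpoly_eval[symmetric]) (use TR_cring is_cring \<phi> in auto)
    also have "\<dots> = \<zero>"
      using I that \<phi>.hom_zero by (simp add: algebraic_subgroup_def)
    finally show ?thesis .
  qed
  then have "\<one>\<^bsub>mat_monoid R\<^esub> \<in> carrier (grp_points R \<phi> I)"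
    using monoid.one_closed[OF group.axioms(1)[OF group_GL]]
    by (auto simp: grp_points_simps GL_one)
  then show "carrier (grp_points R \<phi> I) \<noteq> {}" by blast
next
  fix g :: "('n, 'a) mat"
  assume g: "g \<in> carrier (grp_points R \<phi> I)"
  then have gGL: "g \<in> carrier (GL R)"
    by (simp add: grp_points_simps)
  then have inv_GL: "inv\<^bsub>mat_monoid R\<^esub> g \<in> carrier (GL R)"
    using group.inv_closed[OF group_GL] GL_inv by metis
  note hom = mpoly_eval_hom[OF \<phi> gl_coords_closed[OF gGL]]
  have inv_inv: "inv\<^bsub>mat_monoid R\<^esub> (inv\<^bsub>mat_monoid R\<^esub> g) = g"
    using gGL monoid.Units_inv_inv[OF monoid_mat_monoid] by (simp add: GL_def units_of_carrier)
  have "mpoly_eval R \<phi> (gl_coords R (inv\<^bsub>mat_monoid R\<^esub> g)) f = \<zero>" if "f \<in> I" for f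
  proof -
    \<comment> \<open>Passing to the inverse exchanges the two halves of the coordinates, because
      inverting twice gives back \<open>g\<close>.\<close>
    have "gl_coords R (inv\<^bsub>mat_monoid R\<^esub> g) =
        mpoly_eval R \<phi> (gl_coords R g) \<circ> case_sum (\<lambda>c. var (Inr c)) (\<lambda>c. var (Inl c))"
    proof
      fix v
      have "gl_coords R (inv\<^bsub>mat_monoid R\<^esub> g) v =
          case_sum (\<lambda>c. gl_coords R g (Inr c)) (\<lambda>c. gl_coords R g (Inl c)) v"
        by (auto simp: gl_coords_def inv_inv split: sum.splits)
      then show "gl_coords R (inv\<^bsub>mat_monoid R\<^esub> g) v =
          (mpoly_eval R \<phi> (gl_coords R g) \<circ> case_sum (\<lambda>c. var (Inr c)) (\<lambda>c. var (Inl c))) v"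
        by (cases v)
          (simp_all add: mpoly_eval_var[OF \<phi> gl_coords_closed[OF gGL]] del: One_nat_def)
    qed
    moreover have "mpoly_eval R \<phi> (gl_coords R g) \<circ> cst = \<phi>"
      by (simp add: mpoly_eval_cst[OF \<phi> gl_coords_closed[OF gGL]] fun_eq_iff)
    ultimately have "mpoly_eval R \<phi> (gl_coords R (inv\<^bsub>mat_monoid R\<^esub> g)) f =
        mpoly_eval R \<phi> (gl_coords R g) (antipode f)"
      unfolding antipode_def
      by (subst ring_hom_mpoly_eval[OF TR_cring is_cring hom cst_hom]) simp_all
    also have "\<dots> = \<zero>"
      using g I that by (simp add: algebraic_subgroup_def grp_points_simps)
    finally show ?thesis .
  qed
  then show "inv\<^bsub>GL R\<^esub> g \<in> carrier (grp_points R \<phi> I)"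
    using inv_GL by (simp add: grp_points_simps GL_inv[OF gGL])
next
  fix g h :: "('n, 'a) mat"
  assume g: "g \<in> carrier (grp_points R \<phi> I)" and h: "h \<in> carrier (grp_points R \<phi> I)"
  then have gGL: "g \<in> carrier (GL R)" and hGL: "h \<in> carrier (GL R)"
    by (simp_all add: grp_points_simps)
  have ghGL: "g \<otimes>\<^bsub>mat_monoid R\<^esub> h \<in> carrier (GL R)"
    using monoid.m_closed[OF group.axioms(1)[OF group_GL] gGL hGL] by (simp add: GL_mult)
  \<comment> \<open>The reversed order is the one in which \<open>comult\<close> multiplies the
    inverse coordinates: those of the second factor come first.\<close>
  have inv_gh: "inv\<^bsub>mat_monoid R\<^esub> (g \<otimes>\<^bsub>mat_monoid R\<^esub> h) =
      inv\<^bsub>mat_monoid R\<^esub> h \<otimes>\<^bsub>mat_monoid R\<^esub> inv\<^bsub>mat_monoid R\<^esub> g"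
    using group.inv_mult_group[OF group_GL gGL hGL] GL_inv[OF gGL] GL_inv[OF hGL] GL_inv[OF ghGL]
    by (simp add: GL_mult)
  \<comment> \<open>The pair of \<open>g\<close> and \<open>h\<close> as a single point in the
    doubled set of coordinates.\<close>
  define u where "u = case_sum (gl_coords R g) (gl_coords R h)"
  have u: "u v \<in> carrier R" for v
    using gl_coords_closed[OF gGL] gl_coords_closed[OF hGL] by (simp add: u_def split: sum.splits)
  define ev where "ev = mpoly_eval R \<phi> u"
  have hom: "ev \<in> ring_hom TR R"
    unfolding ev_def by (rule mpoly_eval_hom[OF \<phi> u])
  interpret ev: ring_hom_cring TR R ev
    using TR_cring hom is_cring by (intro ring_hom_cring.intro ring_hom_cring_axioms.intro)
  have ev_cst: "ev \<circ> cst = \<phi>"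
    by (simp add: ev_def mpoly_eval_cst[OF \<phi> u] fun_eq_iff)
  have ev_var: "ev (var v) = u v" for v
    unfolding ev_def by (rule mpoly_eval_var[OF \<phi> u])
  have ev_mpoly_eval: "ev (mpoly_eval TR cst a f) = mpoly_eval R \<phi> (ev \<circ> a) f" for a and f :: "('n, 'k) gl_poly"
    using ring_hom_mpoly_eval[OF TR_cring is_cring hom cst_hom] ev_cst by simp
  have "ev (left_factor f) = mpoly_eval R \<phi> (gl_coords R g) f" for f
    unfolding left_factor_def ev_mpoly_eval
    by (rule arg_cong[where f = "\<lambda>a. mpoly_eval R \<phi> a f"])
      (simp add: fun_eq_iff ev_var u_def del: One_nat_def)
  moreover have "ev (right_factor f) = mpoly_eval R \<phi> (gl_coords R h) f" for f
    unfolding right_factor_def ev_mpoly_eval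
    by (rule arg_cong[where f = "\<lambda>a. mpoly_eval R \<phi> a f"])
      (simp add: fun_eq_iff ev_var u_def del: One_nat_def)
  ultimately have zero: "ev (left_factor f) = \<zero>" "ev (right_factor f) = \<zero>" if "f \<in> I" for f
    using g h that by (simp_all add: grp_points_simps)
  \<comment> \<open>\<open>comult f\<close> lies in the ideal generated by the two copies of
    \<open>I\<close>, and both copies vanish at the pair.\<close>
  have "ev (comult f) = \<zero>" if "f \<in> I" for f
  proof (rule TR_hom_genideal_zero[OF is_cring hom])
    show "comult f \<in> Idl\<^bsub>TR\<^esub> (left_factor ` I \<union> right_factor ` I)"
      using that I by (simp add: algebraic_subgroup_def square_ideal_def)
  qed (use zero in auto)
  moreover have "ev (comult f) = mpoly_eval R \<phi> (gl_coords R (g \<otimes>\<^bsub>mat_monoid R\<^esub> h)) f" for f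
  proof -
    have prod: "ev (\<Sum>l\<in>UNIV. var (a l) * var (b l)) = (\<Oplus>l\<in>UNIV. u (a l) \<otimes> u (b l))" for a b :: "'n \<Rightarrow> _"
      using ev.hom_mult by (simp add: TR_hom_sum[OF is_cring hom] ev_var del: One_nat_def)
    show ?thesis
      unfolding comult_def ev_mpoly_eval
      by (rule arg_cong[where f = "\<lambda>a. mpoly_eval R \<phi> a f"])
        (auto simp: fun_eq_iff prod u_def gl_coords_def inv_gh mat_monoid_simps
          simp del: One_nat_def split: sum.splits)
  qed
  ultimately show "g \<otimes>\<^bsub>GL R\<^esub> h \<in> carrier (grp_points R \<phi> I)"
    using ghGL by (simp add: grp_points_simps GL_mult)
qed

end

section \<open>Completions\<close>

locale valued_field =
  fixes v :: "'f::field \<Rightarrow> int"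
  assumes normalized: "normalized_valuation v"
begin

lemma val_mult: "a \<noteq> 0 \<Longrightarrow> b \<noteq> 0 \<Longrightarrow> v (a * b) = v a + v b"
  and val_ultrametric: "a \<noteq> 0 \<Longrightarrow> b \<noteq> 0 \<Longrightarrow> a + b \<noteq> 0 \<Longrightarrow> min (v a) (v b) \<le> v (a + b)"
  using normalized by (auto simp: normalized_valuation_def)

lemma val_one [simp]: "v 1 = 0"
  using val_mult[of 1 1] by simp

lemma val_minus [simp]: "v (- a) = v a"
proof (cases "a = 0")
  case False
  moreover have "v (- 1) = 0"
    using val_mult[of "- 1" "- 1"] by simp
  ultimately show ?thesis using val_mult[of "- 1" a] by simp
qed simp

lemma val_inverse: "a \<noteq> 0 \<Longrightarrow> v (inverse a) = - v a"
  using val_mult[of a "inverse a"] by simp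

lemma val_ge_zero [simp]: "val_ge v N 0"
  by (simp add: val_ge_def)

lemma val_ge_one [simp]: "val_ge v N 1 \<longleftrightarrow> N \<le> 0"
  by (simp add: val_ge_def)

lemma val_ge_minus [simp]: "val_ge v N (- a) \<longleftrightarrow> val_ge v N a"
  by (simp add: val_ge_def)

lemma val_ge_add: "val_ge v N a \<Longrightarrow> val_ge v N b \<Longrightarrow> val_ge v N (a + b)"
  using val_ultrametric[of a b] by (fastforce simp: val_ge_def)

lemma val_ge_diff: "val_ge v N a \<Longrightarrow> val_ge v N b \<Longrightarrow> val_ge v N (a - b)"
  using val_ge_add[of N a "- b"] by simp

lemma val_ge_mult: "val_ge v M a \<Longrightarrow> val_ge v N b \<Longrightarrow> val_ge v (M + N) (a * b)"
  using val_mult[of a b] by (fastforce simp: val_ge_def)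

lemma val_ge_mono: "val_ge v M a \<Longrightarrow> N \<le> M \<Longrightarrow> val_ge v N a"
  by (auto simp: val_ge_def)

section \<open>The ring of Cauchy sequences and its ideal of null sequences\<close>

abbreviation "CR \<equiv> cauchy_ring v"

lemma cauchy_ring_simps [simp]:
  "s \<otimes>\<^bsub>CR\<^esub> t = (\<lambda>i. s i * t i)" "s \<oplus>\<^bsub>CR\<^esub> t = (\<lambda>i. s i + t i)"
  "\<one>\<^bsub>CR\<^esub> = (\<lambda>_. 1)" "\<zero>\<^bsub>CR\<^esub> = (\<lambda>_. 0)"
  by (simp_all add: cauchy_ring_def)

lemma cauchyD: "s \<in> carrier CR \<Longrightarrow> \<exists>M. \<forall>i\<ge>M. \<forall>j\<ge>M. val_ge v N (s i - s j)"
  by (simp add: cauchy_ring_def)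

lemma cauchyI:
  assumes "\<And>N. \<exists>M. \<forall>i\<ge>M. \<forall>j\<ge>M. val_ge v N (s i - s j)"
  shows "s \<in> carrier CR"
  using assms by (simp add: cauchy_ring_def)

lemma nullD: "s \<in> null_sequences v \<Longrightarrow> \<exists>M. \<forall>i\<ge>M. val_ge v N (s i)"
  by (simp add: null_sequences_def)

lemma nullI:
  assumes "\<And>N. \<exists>M. \<forall>i\<ge>M. val_ge v N (s i)"
  shows "s \<in> null_sequences v"
  using assms by (simp add: null_sequences_def)

lemma null_imp_cauchy:
  assumes "s \<in> null_sequences v"
  shows "s \<in> carrier CR"
proof (rule cauchyI)
  fix N
  obtain M where "\<forall>i\<ge>M. val_ge v N (s i)"
    using nullD[OF assms] by blast
  then have "\<forall>i\<ge>M. \<forall>j\<ge>M. val_ge v N (s i - s j)"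
    by (simp add: val_ge_diff)
  then show "\<exists>M. \<forall>i\<ge>M. \<forall>j\<ge>M. val_ge v N (s i - s j)" ..
qed

lemma cauchy_const: "(\<lambda>_. a) \<in> carrier CR"
  by (rule cauchyI) simp

lemma cauchy_add:
  assumes "s \<in> carrier CR" "t \<in> carrier CR"
  shows "(\<lambda>i. s i + t i) \<in> carrier CR"
proof (rule cauchyI)
  fix N
  obtain M\<^sub>1 where M\<^sub>1: "\<And>i j. i \<ge> M\<^sub>1 \<Longrightarrow> j \<ge> M\<^sub>1 \<Longrightarrow> val_ge v N (s i - s j)"
    using cauchyD[OF assms(1)] by blast
  obtain M\<^sub>2 where M\<^sub>2: "\<And>i j. i \<ge> M\<^sub>2 \<Longrightarrow> j \<ge> M\<^sub>2 \<Longrightarrow> val_ge v N (t i - t j)"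
    using cauchyD[OF assms(2)] by blast
  have "val_ge v N (s i + t i - (s j + t j))" if "i \<ge> max M\<^sub>1 M\<^sub>2" "j \<ge> max M\<^sub>1 M\<^sub>2" for i j
    using val_ge_add[OF M\<^sub>1[of i j] M\<^sub>2[of i j]] that by (simp add: algebra_simps)
  then show "\<exists>M. \<forall>i\<ge>M. \<forall>j\<ge>M. val_ge v N (s i + t i - (s j + t j))" by blast
qed

lemma cauchy_minus:
  assumes "s \<in> carrier CR"
  shows "(\<lambda>i. - s i) \<in> carrier CR"
proof (rule cauchyI)
  fix N
  obtain M where "\<And>i j. i \<ge> M \<Longrightarrow> j \<ge> M \<Longrightarrow> val_ge v N (s i - s j)"
    using cauchyD[OF assms] by blast
  then show "\<exists>M. \<forall>i\<ge>M. \<forall>j\<ge>M. val_ge v N (- s i - - s j)"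
    by (metis (no_types, lifting) diff_minus_eq_add uminus_add_conv_diff)
qed

text \<open>From some \<open>M\<close> on, s_i = (s_i - s_M) + s_M, where the difference has value
  at least 0; the ultrametric inequality bounds the tail by the smaller of 0 and the value of s_M.
  If s_M = 0 the dummy value there does no harm.\<close>

lemma cauchy_bounded:
  assumes "s \<in> carrier CR"
  shows "\<exists>B M. \<forall>i\<ge>M. val_ge v B (s i)"
proof -
  obtain M where M: "\<And>i j. i \<ge> M \<Longrightarrow> j \<ge> M \<Longrightarrow> val_ge v 0 (s i - s j)"
    using cauchyD[OF assms] by blast
  have "val_ge v (min 0 (v (s M))) (s i)" if "i \<ge> M" for i
  proof -
    have "val_ge v (min 0 (v (s M))) (s i - s M)"
      by (rule val_ge_mono[OF M]) (use that in auto)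
    moreover have "val_ge v (min 0 (v (s M))) (s M)"
      by (simp add: val_ge_def)
    ultimately show ?thesis using val_ge_add by fastforce
  qed
  then show ?thesis by blast
qed

lemma cauchy_mult:
  assumes "s \<in> carrier CR" "t \<in> carrier CR"
  shows "(\<lambda>i. s i * t i) \<in> carrier CR"
proof (rule cauchyI)
  fix N
  obtain B M\<^sub>0 where B: "\<And>i. i \<ge> M\<^sub>0 \<Longrightarrow> val_ge v B (s i)"
    using cauchy_bounded[OF assms(1)] by blast
  obtain C M\<^sub>1 where C: "\<And>i. i \<ge> M\<^sub>1 \<Longrightarrow> val_ge v C (t i)"
    using cauchy_bounded[OF assms(2)] by blast
  \<comment> \<open>The precisions \<open>N - C\<close> and \<open>N - B\<close> compensate the
    lower bounds of the other factor in s_i t_i - s_j t_j = s_i (t_i - t_j) + (s_i - s_j)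
    t_j.\<close>
  obtain M\<^sub>2 where M\<^sub>2: "\<And>i j. i \<ge> M\<^sub>2 \<Longrightarrow> j \<ge> M\<^sub>2 \<Longrightarrow> val_ge v (N - C) (s i - s j)"
    using cauchyD[OF assms(1)] by blast
  obtain M\<^sub>3 where M\<^sub>3: "\<And>i j. i \<ge> M\<^sub>3 \<Longrightarrow> j \<ge> M\<^sub>3 \<Longrightarrow> val_ge v (N - B) (t i - t j)"
    using cauchyD[OF assms(2)] by blast
  define M where "M = Max {M\<^sub>0, M\<^sub>1, M\<^sub>2, M\<^sub>3}"
  have "val_ge v N (s i * t i - s j * t j)" if "i \<ge> M" "j \<ge> M" for i j
  proof -
    have "val_ge v (B + (N - B)) (s i * (t i - t j))" "val_ge v (N - C + C) ((s i - s j) * t j)"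
      by (intro val_ge_mult B C M\<^sub>2 M\<^sub>3; use that in \<open>simp add: M_def\<close>)+
    then have "val_ge v N (s i * (t i - t j) + (s i - s j) * t j)"
      by (auto intro: val_ge_add)
    then show ?thesis by (simp add: algebra_simps)
  qed
  then show "\<exists>M. \<forall>i\<ge>M. \<forall>j\<ge>M. val_ge v N (s i * t i - s j * t j)" by blast
qed

lemma null_add:
  assumes "s \<in> null_sequences v" "t \<in> null_sequences v"
  shows "(\<lambda>i. s i + t i) \<in> null_sequences v"
proof (rule nullI)
  fix N
  obtain M\<^sub>1 where "\<And>i. i \<ge> M\<^sub>1 \<Longrightarrow> val_ge v N (s i)"
    using nullD[OF assms(1)] by blast
  moreover obtain M\<^sub>2 where "\<And>i. i \<ge> M\<^sub>2 \<Longrightarrow> val_ge v N (t i)"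
    using nullD[OF assms(2)] by blast
  ultimately have "\<forall>i\<ge>max M\<^sub>1 M\<^sub>2. val_ge v N (s i + t i)"
    by (simp add: val_ge_add)
  then show "\<exists>M. \<forall>i\<ge>M. val_ge v N (s i + t i)" ..
qed

lemma null_mult:
  assumes "s \<in> null_sequences v" "t \<in> carrier CR"
  shows "(\<lambda>i. t i * s i) \<in> null_sequences v"
proof (rule nullI)
  fix N
  obtain B M\<^sub>1 where B: "\<And>i. i \<ge> M\<^sub>1 \<Longrightarrow> val_ge v B (t i)"
    using cauchy_bounded[OF assms(2)] by blast
  obtain M\<^sub>2 where M\<^sub>2: "\<And>i. i \<ge> M\<^sub>2 \<Longrightarrow> val_ge v (N - B) (s i)"
    using nullD[OF assms(1)] by blast
  have "\<forall>i\<ge>max M\<^sub>1 M\<^sub>2. val_ge v (B + (N - B)) (t i * s i)"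
    by (intro allI impI val_ge_mult B M\<^sub>2) simp_all
  then have "\<forall>i\<ge>max M\<^sub>1 M\<^sub>2. val_ge v N (t i * s i)"
    by (simp only: add_diff_eq add_diff_cancel_left')
  then show "\<exists>M. \<forall>i\<ge>M. val_ge v N (t i * s i)" ..
qed

lemma null_minus: "s \<in> null_sequences v \<Longrightarrow> (\<lambda>i. - s i) \<in> null_sequences v"
  using null_mult[OF _ cauchy_const[of "- 1"]] by simp

lemma cring_cauchy_ring: "cring CR"
proof (rule cringI)
  show "abelian_group CR"
  proof (rule abelian_groupI)
    fix s t u
    assume s: "s \<in> carrier CR" and t: "t \<in> carrier CR" and "u \<in> carrier CR"
    show "s \<oplus>\<^bsub>CR\<^esub> t \<in> carrier CR"
      using cauchy_add[OF s t] by simp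
    show "s \<oplus>\<^bsub>CR\<^esub> t \<oplus>\<^bsub>CR\<^esub> u = s \<oplus>\<^bsub>CR\<^esub> (t \<oplus>\<^bsub>CR\<^esub> u)"
      by (simp add: add.assoc)
    show "s \<oplus>\<^bsub>CR\<^esub> t = t \<oplus>\<^bsub>CR\<^esub> s"
      by (simp add: add.commute)
    show "\<zero>\<^bsub>CR\<^esub> \<oplus>\<^bsub>CR\<^esub> s = s"
      by simp
    show "\<exists>t\<in>carrier CR. t \<oplus>\<^bsub>CR\<^esub> s = \<zero>\<^bsub>CR\<^esub>"
      by (rule bexI[OF _ cauchy_minus[OF s]]) simp
  qed (simp add: cauchy_const)
  show "comm_monoid CR"
  proof (rule comm_monoidI)
    fix s t u
    assume s: "s \<in> carrier CR" and t: "t \<in> carrier CR" and "u \<in> carrier CR"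
    show "s \<otimes>\<^bsub>CR\<^esub> t \<in> carrier CR"
      using cauchy_mult[OF s t] by simp
    show "s \<otimes>\<^bsub>CR\<^esub> t \<otimes>\<^bsub>CR\<^esub> u = s \<otimes>\<^bsub>CR\<^esub> (t \<otimes>\<^bsub>CR\<^esub> u)"
      by (simp add: mult.assoc)
    show "s \<otimes>\<^bsub>CR\<^esub> t = t \<otimes>\<^bsub>CR\<^esub> s"
      by (simp add: mult.commute)
    show "\<one>\<^bsub>CR\<^esub> \<otimes>\<^bsub>CR\<^esub> s = s"
      by simp
  qed (simp add: cauchy_const)
  fix s t u
  show "(s \<oplus>\<^bsub>CR\<^esub> t) \<otimes>\<^bsub>CR\<^esub> u = s \<otimes>\<^bsub>CR\<^esub> u \<oplus>\<^bsub>CR\<^esub> t \<otimes>\<^bsub>CR\<^esub> u"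
    by (simp add: distrib_right)
qed

sublocale CR: cring CR
  by (rule cring_cauchy_ring)

lemma cauchy_a_inv: "s \<in> carrier CR \<Longrightarrow> \<ominus>\<^bsub>CR\<^esub> s = (\<lambda>i. - s i)"
  by (rule CR.minus_equality) (simp_all add: cauchy_minus)

lemma cauchy_a_minus: "s \<in> carrier CR \<Longrightarrow> t \<in> carrier CR \<Longrightarrow> s \<ominus>\<^bsub>CR\<^esub> t = (\<lambda>i. s i - t i)"
  by (simp add: a_minus_def cauchy_a_inv)

lemma ideal_null_sequences: "ideal (null_sequences v) CR"
proof (rule idealI)
  show "subgroup (null_sequences v) (add_monoid CR)"
  proof (rule CR.add.subgroupI)
    show "null_sequences v \<noteq> {}"
      using nullI[of "\<lambda>_. 0"] by auto
  qed (auto simp: null_imp_cauchy cauchy_a_inv null_add null_minus)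
next
  fix s t assume "s \<in> null_sequences v" "t \<in> carrier CR"
  from null_mult[OF this] show "t \<otimes>\<^bsub>CR\<^esub> s \<in> null_sequences v" "s \<otimes>\<^bsub>CR\<^esub> t \<in> null_sequences v"
    by (simp_all add: mult.commute)
qed (rule CR.ring_axioms)

sublocale null: ideal "null_sequences v" CR
  by (rule ideal_null_sequences)

section \<open>The completion as a quotient of the ring of Cauchy sequences\<close>

definition cls :: "(nat \<Rightarrow> 'f) \<Rightarrow> (nat \<Rightarrow> 'f) set"
  where "cls s = null_sequences v +>\<^bsub>CR\<^esub> s"

abbreviation "F\<^sub>v \<equiv> completion v"
abbreviation "O\<^sub>v \<equiv> completed_local_ring v"

lemma cring_completion: "cring F\<^sub>v"
  unfolding completion_def by (rule null.quotient_is_cring[OF cring_cauchy_ring])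

sublocale F: cring F\<^sub>v
  by (rule cring_completion)

lemma cls_hom: "cls \<in> ring_hom CR F\<^sub>v"
  using null.rcos_ring_hom by (simp add: completion_def cls_def[abs_def])

sublocale cls: ring_hom_ring CR F\<^sub>v cls
  by (rule ring_hom_ringI2) (auto simp: CR.ring_axioms F.ring_axioms cls_hom)

lemma completion_carrierE:
  assumes "C \<in> carrier F\<^sub>v"
  obtains s where "s \<in> carrier CR" "C = cls s"
  using assms by (auto simp: completion_def FactRing_def A_RCOSETS_def' cls_def a_r_coset_def')

lemma cls_eq_iff:
  assumes "s \<in> carrier CR" "t \<in> carrier CR"
  shows "cls s = cls t \<longleftrightarrow> (\<lambda>i. s i - t i) \<in> null_sequences v"
  using CR.quotient_eq_iff_same_a_r_cos[OF ideal_null_sequences assms] cauchy_a_minus[OF assms]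
  by (simp add: cls_def)

lemma to_completion_hom: "to_completion v \<in> ring_hom TR F\<^sub>v"
proof -
  have "(\<lambda>a _. a) \<in> ring_hom TR CR"
    by (rule ring_hom_memI) (simp_all add: cauchy_const)
  from ring_hom_trans[OF this cls_hom] show ?thesis
    by (simp add: comp_def cls_def to_completion_def[abs_def])
qed

lemma to_completion_cls: "to_completion v a = cls (\<lambda>_. a)"
  by (simp add: to_completion_def cls_def)

subsection \<open>The completed local ring\<close>

text \<open>A class is integral as soon as one representative has integral terms. Collecting such
  representatives presents the completed local ring as the image of a subring under
  \<open>cls\<close>, hence as a subring of the completion.\<close>

definition integral_sequences :: "(nat \<Rightarrow> 'f) set"
  where "integral_sequences = {s \<in> carrier CR. \<forall>i. val_ge v 0 (s i)}"

lemma completed_local_ring_carrier: "carrier O\<^sub>v = cls ` integral_sequences"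
proof -
  have "C \<in> cls ` integral_sequences"
    if "C \<in> carrier F\<^sub>v" "s \<in> C" "\<forall>i. val_ge v 0 (s i)" for C s
  proof -
    obtain t where t: "t \<in> carrier CR" "C = cls t"
      using \<open>C \<in> carrier F\<^sub>v\<close> by (rule completion_carrierE)
    then have "s \<in> carrier CR" "cls s = C"
      using that(2) null.a_elemrcos_carrier null.a_repr_independence'
      by (auto simp: cls_def)
    then show ?thesis using that(3) by (auto simp: integral_sequences_def)
  qed
  moreover have "s \<in> cls s" if "s \<in> carrier CR" for s
    using that null.a_rcos_self by (simp add: cls_def)
  ultimately show ?thesis
    using cls.hom_closed by (fastforce simp: completed_local_ring_def integral_sequences_def)
qed

lemma subring_integral_sequences: "subring integral_sequences CR"
proof (rule CR.subringI)
  fix s t assume "s \<in> integral_sequences" "t \<in> integral_sequences"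
  then show "s \<otimes>\<^bsub>CR\<^esub> t \<in> integral_sequences" "s \<oplus>\<^bsub>CR\<^esub> t \<in> integral_sequences"
    using val_ge_mult[of 0 _ 0]
    by (auto simp: integral_sequences_def cauchy_mult cauchy_add val_ge_add)
qed (auto simp: integral_sequences_def cauchy_const cauchy_minus cauchy_a_inv)

lemma subcring_completed_local_ring: "subcring (carrier O\<^sub>v) F\<^sub>v"
  unfolding completed_local_ring_carrier
  by (intro F.subcringI' cls.img_is_subring subring_integral_sequences)

lemma completed_local_ring_eq: "O\<^sub>v = F\<^sub>v\<lparr>carrier := carrier O\<^sub>v\<rparr>"
  by (simp add: completed_local_ring_def)

lemma cring_completed_local_ring: "cring O\<^sub>v"
  using F.subcring_iff[OF subcringE(1)[OF subcring_completed_local_ring]] subcring_completed_local_ring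
  by (simp add: completed_local_ring_eq[symmetric])

sublocale O: cring O\<^sub>v
  by (rule cring_completed_local_ring)

lemma completed_local_ring_simps:
  "a \<otimes>\<^bsub>O\<^sub>v\<^esub> b = a \<otimes>\<^bsub>F\<^sub>v\<^esub> b" "a \<oplus>\<^bsub>O\<^sub>v\<^esub> b = a \<oplus>\<^bsub>F\<^sub>v\<^esub> b" "\<one>\<^bsub>O\<^sub>v\<^esub> = \<one>\<^bsub>F\<^sub>v\<^esub>" "\<zero>\<^bsub>O\<^sub>v\<^esub> = \<zero>\<^bsub>F\<^sub>v\<^esub>"
  by (simp_all add: completed_local_ring_def)

lemma completed_local_ring_inclusion: "(\<lambda>a. a) \<in> ring_hom O\<^sub>v F\<^sub>v"
  using subcringE(1)[OF subcring_completed_local_ring]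
  by (intro ring_hom_memI) (auto simp: completed_local_ring_simps)

lemma to_completion_integral: "val_ge v 0 a \<Longrightarrow> to_completion v a \<in> carrier O\<^sub>v"
  by (auto simp: completed_local_ring_carrier to_completion_cls integral_sequences_def cauchy_const)

subsection \<open>Uniformizers are units of the completion\<close>

text \<open>A Cauchy sequence that is not null eventually has values bounded above, so its inverses
  are bounded and 1/s_i - 1/s_j = (s_j - s_i) / (s_i s_j) becomes small.\<close>

lemma inverse_cauchy:
  assumes s: "s \<in> carrier CR" "s \<notin> null_sequences v"
  shows "(\<lambda>i. inverse (s i)) \<in> carrier CR"
    and "(\<lambda>i. s i * inverse (s i) - 1) \<in> null_sequences v"
proof -
  obtain N where N: "\<And>M. \<exists>i\<ge>M. \<not> val_ge v N (s i)"
    using s(2) by (auto simp: null_sequences_def)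
  obtain M where M: "\<And>i j. i \<ge> M \<Longrightarrow> j \<ge> M \<Longrightarrow> val_ge v N (s i - s j)"
    using cauchyD[OF s(1)] by blast
  obtain i\<^sub>0 where i\<^sub>0: "i\<^sub>0 \<ge> M" "\<not> val_ge v N (s i\<^sub>0)"
    using N by blast
  \<comment> \<open>Terms beyond \<open>M\<close> differ by value at least \<open>N\<close>; if one
    of them reached \<open>N\<close>, so would the term at \<open>i\<^sub>0\<close>.\<close>
  have "\<not> val_ge v N (s i)" if "i \<ge> M" for i
    using val_ge_add[OF M[of i\<^sub>0 i], of "s i"] that i\<^sub>0 by auto
  then have nonzero: "s i \<noteq> 0" and bound: "val_ge v (- N) (inverse (s i))" if "i \<ge> M" for i
    using that val_inverse[of "s i"] by (force simp: val_ge_def)+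
  show "(\<lambda>i. inverse (s i)) \<in> carrier CR"
  proof (rule cauchyI)
    fix K
    \<comment> \<open>The extra \<open>2 * N\<close> pays for the two inverses, each of which is
      only known to have value at least \<open>- N\<close>.\<close>
    obtain L where L: "\<And>i j. i \<ge> L \<Longrightarrow> j \<ge> L \<Longrightarrow> val_ge v (K + 2 * N) (s i - s j)"
      using cauchyD[OF s(1)] by blast
    have "val_ge v K (inverse (s i) - inverse (s j))" if "i \<ge> max L M" "j \<ge> max L M" for i j
    proof -
      have "val_ge v (- N + (K + 2 * N) + - N) (inverse (s i) * (s j - s i) * inverse (s j))"
        using that by (intro val_ge_mult bound L) auto
      then show ?thesis
        using nonzero[of i] nonzero[of j] that by (simp add: field_simps)
    qed
    then show "\<exists>M. \<forall>i\<ge>M. \<forall>j\<ge>M. val_ge v K (inverse (s i) - inverse (s j))" by blast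
  qed
  \<comment> \<open>From \<open>M\<close> on the terms are exactly 0; earlier ones may be -1, since
    the inverse of 0 is 0, but there are finitely many of them.\<close>
  show "(\<lambda>i. s i * inverse (s i) - 1) \<in> null_sequences v"
    by (rule nullI) (use nonzero in \<open>auto intro!: exI[of _ M]\<close>)
qed

lemma completion_nonzero_unit:
  assumes "C \<in> carrier F\<^sub>v" "C \<noteq> \<zero>\<^bsub>F\<^sub>v\<^esub>"
  shows "C \<in> Units F\<^sub>v"
proof -
  obtain s where s: "s \<in> carrier CR" "C = cls s"
    using assms(1) by (rule completion_carrierE)
  have "s \<notin> null_sequences v"
    using assms(2) cls_eq_iff[OF s(1) CR.zero_closed] s cls.hom_zero by auto
  note inv = inverse_cauchy[OF s(1) this]
  have "cls s \<otimes>\<^bsub>F\<^sub>v\<^esub> cls (\<lambda>i. inverse (s i)) = cls (\<lambda>i. s i * inverse (s i))"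
    using cls.hom_mult[OF s(1) inv(1)] by simp
  also have "\<dots> = cls (\<lambda>_. 1)"
    using inv s(1) by (subst cls_eq_iff) (simp_all add: cauchy_mult cauchy_const)
  also have "\<dots> = \<one>\<^bsub>F\<^sub>v\<^esub>"
    using cls.hom_one by simp
  finally have "cls s \<otimes>\<^bsub>F\<^sub>v\<^esub> cls (\<lambda>i. inverse (s i)) = \<one>\<^bsub>F\<^sub>v\<^esub>" .
  moreover from this have "cls (\<lambda>i. inverse (s i)) \<otimes>\<^bsub>F\<^sub>v\<^esub> cls s = \<one>\<^bsub>F\<^sub>v\<^esub>"
    using F.m_comm[OF cls.hom_closed[OF s(1)] cls.hom_closed[OF inv(1)]] by simp
  ultimately show ?thesis
    using s cls.hom_closed[OF inv(1)] cls.hom_closed[OF s(1)] by (auto simp: Units_def)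
qed

text \<open>An element of value 1 has no integral inverse: the product with an integral sequence
  keeps value at least 1, and if it tended to 1 then 1 itself would have value at least 1.\<close>

lemma completed_local_ring_not_field: "\<not> field O\<^sub>v"
proof
  assume "field O\<^sub>v"
  obtain a where a: "a \<noteq> 0" "v a = 1"
    using normalized by (auto simp: normalized_valuation_def)
  have const: "(\<lambda>_. a) \<in> integral_sequences"
    using a by (simp add: integral_sequences_def cauchy_const val_ge_def)
  \<comment> \<open>All terms have value exactly 1, so the threshold 2 is never reached.\<close>
  have "(\<lambda>_. a) \<notin> null_sequences v"
    using nullD[of "\<lambda>_. a" 2] a by (auto simp: val_ge_def)
  then have "cls (\<lambda>_. a) \<noteq> \<zero>\<^bsub>O\<^sub>v\<^esub>"
    using cls_eq_iff[OF cauchy_const CR.zero_closed, of a] cls.hom_zero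
    by (simp add: completed_local_ring_simps)
  moreover have "cls (\<lambda>_. a) \<in> carrier O\<^sub>v"
    using const by (simp add: completed_local_ring_carrier)
  ultimately have "cls (\<lambda>_. a) \<in> Units O\<^sub>v"
    using \<open>field O\<^sub>v\<close> by (simp add: field.field_Units)
  then obtain y where y: "y \<in> carrier O\<^sub>v" "y \<otimes>\<^bsub>O\<^sub>v\<^esub> cls (\<lambda>_. a) = \<one>\<^bsub>O\<^sub>v\<^esub>"
    by (auto simp: Units_def)
  then obtain s where s: "s \<in> integral_sequences" "y = cls s"
    by (auto simp: completed_local_ring_carrier)
  then have s': "s \<in> carrier CR"
    by (simp add: integral_sequences_def)
  have "cls (\<lambda>i. s i * a) = cls (\<lambda>_. 1)"
    using y(2) s cls.hom_mult[OF s' cauchy_const[of a]] cls.hom_one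
    by (simp add: completed_local_ring_simps)
  then have "(\<lambda>i. s i * a - 1) \<in> null_sequences v"
    using s' cls_eq_iff[OF cauchy_mult[OF s' cauchy_const[of a]] cauchy_const[of 1]] by simp
  then obtain M where "val_ge v 1 (s M * a - 1)"
    using nullD by blast
  moreover have "val_ge v 1 (s M * a)"
    using val_ge_mult[of 0 "s M" 1 a] s a by (simp add: integral_sequences_def val_ge_def)
  ultimately show False
    using val_ge_diff[of 1 "s M * a" "s M * a - 1"] by simp
qed

text \<open>If \<open>p\<close> were zero, the zero ideal would be maximal and the completed local
  ring a field.\<close>

lemma uniformizer_unit:
  assumes "uniformizer v p"
  shows "p \<in> Units F\<^sub>v"
proof (rule completion_nonzero_unit)
  show "p \<in> carrier F\<^sub>v"
    using assms subcringE(1)[OF subcring_completed_local_ring] by (auto simp: uniformizer_def)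
  show "p \<noteq> \<zero>\<^bsub>F\<^sub>v\<^esub>"
  proof
    assume "p = \<zero>\<^bsub>F\<^sub>v\<^esub>"
    then have "PIdl\<^bsub>O\<^sub>v\<^esub> p = {\<zero>\<^bsub>O\<^sub>v\<^esub>}"
      using O.genideal_zero O.cgenideal_eq_genideal[OF O.zero_closed]
      by (simp add: completed_local_ring_simps)
    then show False
      using assms O.zeromaximalideal_fieldI completed_local_ring_not_field
      by (simp add: uniformizer_def)
  qed
qed

end

section \<open>Hecke graphs of an abstract group\<close>

context group
begin

text \<open>Identifies the product set by which \<open>hecke_digraph\<close> defines heads with the
  double coset of the representative times \<open>s\<close>.\<close>

lemma r_coset_mult_l_coset:
  assumes "M \<subseteq> carrier G" "K \<subseteq> carrier G" "g \<in> carrier G" "s \<in> carrier G"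
  shows "(M #> g) <#> (s <# K) = (M #> (g \<otimes> s)) <#> K"
  using assms by (metis coset_mult_assoc r_coset_subset_G rcos_assoc_lcos)

lemma subgroup_set_mult_absorb:
  assumes "subgroup H G" "subgroup K G" "H \<subseteq> K"
  shows "H <#> K = K"
proof
  show "H <#> K \<subseteq> K"
    using mono_set_mult[OF assms(3) order_refl] subgroup_mult_id[OF assms(2)] by blast
  show "K \<subseteq> H <#> K"
    using subgroup.one_closed[OF assms(1)] subgroup.mem_carrier[OF assms(2)]
    by (force simp: set_mult_def)
qed

lemma double_coset_refl:
  assumes "subgroup \<Gamma> G" "subgroup K G" "g \<in> carrier G"
  shows "g \<in> double_coset G \<Gamma> K g"
proof -
  have "g = \<one> \<otimes> g \<otimes> \<one>" using assms by simp
  then show ?thesis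
    using subgroup.one_closed[OF assms(1)] subgroup.one_closed[OF assms(2)]
    unfolding double_coset_def r_coset_def set_mult_def by blast
qed

lemma double_coset_left:
  assumes "subgroup \<Gamma> G" "\<gamma> \<in> \<Gamma>" "g \<in> carrier G"
  shows "double_coset G \<Gamma> K (\<gamma> \<otimes> g) = double_coset G \<Gamma> K g"
proof -
  have "\<gamma> \<in> carrier G" "\<Gamma> \<subseteq> carrier G"
    using assms subgroup.subset by auto
  then have "\<Gamma> #> (\<gamma> \<otimes> g) = \<Gamma> #> g"
    using coset_join2[OF _ assms(1,2)] assms(3) by (simp flip: coset_mult_assoc)
  then show ?thesis by (simp add: double_coset_def)
qed

lemma double_coset_mult_subgroup:
  assumes "\<Gamma> \<subseteq> carrier G" "subgroup K\<^sub>1 G" "subgroup K\<^sub>2 G" "K\<^sub>1 \<subseteq> K\<^sub>2" "g \<in> carrier G"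
  shows "double_coset G \<Gamma> K\<^sub>1 g <#> K\<^sub>2 = double_coset G \<Gamma> K\<^sub>2 g"
  unfolding double_coset_def
  using assms by (subst set_mult_assoc) (auto simp: subgroup_set_mult_absorb subgroup.subset r_coset_subset_G)

lemma l_coset_mult_subgroup:
  assumes "subgroup K\<^sub>1 G" "subgroup K\<^sub>2 G" "K\<^sub>1 \<subseteq> K\<^sub>2" "g \<in> carrier G"
  shows "(g <# K\<^sub>1) <#> K\<^sub>2 = g <# K\<^sub>2"
  using assms by (simp add: setmult_lcos_assoc subgroup_set_mult_absorb subgroup.subset)

lemma l_coset_eq_iff:
  assumes "subgroup K G" "g \<in> carrier G" "h \<in> carrier G"
  shows "g <# K = h <# K \<longleftrightarrow> (\<exists>k\<in>K. g = h \<otimes> k)"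
proof
  assume "g <# K = h <# K"
  moreover have "g \<in> g <# K"
    using subgroup.one_closed[OF assms(1)] assms(2) unfolding l_coset_def by force
  ultimately show "\<exists>k\<in>K. g = h \<otimes> k" by (auto simp: l_coset_def)
next
  assume "\<exists>k\<in>K. g = h \<otimes> k"
  then have "g \<in> h <# K" by (auto simp: l_coset_def)
  then show "g <# K = h <# K" using l_repr_independence[OF _ assms(3,1)] by simp
qed

text \<open>The right factor of an element of the double coset is absorbed by \<open>K\<close>, so
  edges can be parametrized, with repetitions, by \<open>k\<close> in \<open>K\<close>.\<close>

lemma double_coset_left_cosets:
  assumes K: "subgroup K G" and \<Delta>: "\<Delta> \<in> carrier G"
  shows "(\<lambda>\<sigma>. \<sigma> <# K) ` double_coset G K K \<Delta> = (\<lambda>k. (k \<otimes> \<Delta>) <# K) ` K"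
proof -
  have "(k \<otimes> \<Delta> \<otimes> k') <# K = (k \<otimes> \<Delta>) <# K" if "k \<in> K" "k' \<in> K" for k k'
    using that \<Delta> subgroup.mem_carrier[OF K] by (subst l_coset_eq_iff[OF K]) auto
  moreover have "double_coset G K K \<Delta> = {k \<otimes> \<Delta> \<otimes> k' | k k'. k \<in> K \<and> k' \<in> K}"
    by (auto simp: double_coset_def r_coset_def set_mult_def)
  ultimately show ?thesis
    using subgroup.one_closed[OF K] by (auto simp: image_iff)
qed

text \<open>The arithmetic enters through two conditions: \<open>cover\<close> yields surjectivity
  on edges and \<open>separate\<close> injectivity. The last claim holds for every admissible pair
  \<gamma>, \<kappa>, so the bijection does not depend on how the two representatives are
  related.\<close>

theorem hecke_digraph_level_change:
  assumes A: "A = G\<lparr>carrier := U\<rparr>" "U \<subseteq> carrier G"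
    and \<Gamma>: "subgroup \<Gamma> G" and K\<^sub>1: "subgroup K\<^sub>1 G" and K\<^sub>2: "subgroup K\<^sub>2 G" and K\<^sub>1\<^sub>2: "K\<^sub>1 \<subseteq> K\<^sub>2"
    and \<Delta>: "\<Delta> \<in> carrier G"
    and cover: "\<forall>k\<in>K\<^sub>2. \<exists>k'\<in>K\<^sub>1. \<exists>\<kappa>\<in>K\<^sub>2. k \<otimes> \<Delta> = k' \<otimes> \<Delta> \<otimes> \<kappa>"
    and separate: "\<forall>k\<in>K\<^sub>1. \<forall>k'\<in>K\<^sub>1. \<forall>\<kappa>\<in>K\<^sub>2. k \<otimes> \<Delta> = k' \<otimes> \<Delta> \<otimes> \<kappa> \<longrightarrow> \<kappa> \<in> K\<^sub>1"
    and r\<^sub>1: "vertex_representatives A \<Gamma> K\<^sub>1 r\<^sub>1" and r\<^sub>2: "vertex_representatives A \<Gamma> K\<^sub>2 r\<^sub>2"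
    and graph\<^sub>1: "graph\<^sub>1 = hecke_digraph A \<Gamma> K\<^sub>1 \<Delta> r\<^sub>1"
    and graph\<^sub>2: "graph\<^sub>2 = hecke_digraph A \<Gamma> K\<^sub>2 \<Delta> r\<^sub>2"
  shows "\<forall>g\<in>carrier A. vertex_map A K\<^sub>2 (double_coset A \<Gamma> K\<^sub>1 g) = double_coset A \<Gamma> K\<^sub>2 g"
    and "vertex_map A K\<^sub>2 ` verts graph\<^sub>1 = verts graph\<^sub>2"
    and "\<lbrakk>a \<in> verts graph\<^sub>2; a' \<in> verts graph\<^sub>1; vertex_map A K\<^sub>2 a' = a\<rbrakk> \<Longrightarrow>
      \<exists>\<gamma>\<in>\<Gamma>. \<exists>\<kappa>\<in>K\<^sub>2. r\<^sub>1 a' = \<gamma> \<otimes>\<^bsub>A\<^esub> r\<^sub>2 a \<otimes>\<^bsub>A\<^esub> \<kappa>"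
    and "\<lbrakk>a \<in> verts graph\<^sub>2; a' \<in> verts graph\<^sub>1; \<gamma> \<in> \<Gamma>; \<kappa> \<in> K\<^sub>2;
      r\<^sub>1 a' = \<gamma> \<otimes>\<^bsub>A\<^esub> r\<^sub>2 a \<otimes>\<^bsub>A\<^esub> \<kappa>\<rbrakk> \<Longrightarrow>
      bij_betw (edge_map A K\<^sub>2 a \<kappa>)
        {e \<in> arcs graph\<^sub>1. tail graph\<^sub>1 e = a' \<and> vertex_map A K\<^sub>2 (head graph\<^sub>1 e) = b}
        {e \<in> arcs graph\<^sub>2. tail graph\<^sub>2 e = a \<and> head graph\<^sub>2 e = b}"
proof -
  note sub = subgroup.subset[OF \<Gamma>] subgroup.subset[OF K\<^sub>1] subgroup.subset[OF K\<^sub>2]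
  \<comment> \<open>These notions see only the multiplication of \<open>A\<close>, which is that of
    \<open>G\<close>; the carrier \<open>U\<close> merely selects which double cosets are
    vertices.\<close>
  have coset_A [simp]: "double_coset A = double_coset G" "vertex_map A = vertex_map G"
    "edge_map A = edge_map G" "g \<otimes>\<^bsub>A\<^esub> h = g \<otimes> h" "carrier A = U" for g h
    by (simp_all add: A(1) double_coset_def vertex_map_def edge_map_def fun_eq_iff)
  have vertex_map: "vertex_map G K\<^sub>2 (double_coset G \<Gamma> K\<^sub>1 g) = double_coset G \<Gamma> K\<^sub>2 g"
    if "g \<in> carrier G" for g
    unfolding vertex_map_def by (rule double_coset_mult_subgroup[OF sub(1) K\<^sub>1 K\<^sub>2 K\<^sub>1\<^sub>2 that])
  then show "\<forall>g\<in>carrier A. vertex_map A K\<^sub>2 (double_coset A \<Gamma> K\<^sub>1 g) = double_coset A \<Gamma> K\<^sub>2 g"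
    using A(2) by auto
  have verts: "verts graph\<^sub>1 = double_coset G \<Gamma> K\<^sub>1 ` U" "verts graph\<^sub>2 = double_coset G \<Gamma> K\<^sub>2 ` U"
    by (simp_all add: graph\<^sub>1 graph\<^sub>2 hecke_digraph_def)
  show "vertex_map A K\<^sub>2 ` verts graph\<^sub>1 = verts graph\<^sub>2"
    unfolding verts coset_A image_image using vertex_map A(2) by (intro image_cong) auto
  have rep\<^sub>1: "r\<^sub>1 v \<in> carrier G" "double_coset G \<Gamma> K\<^sub>1 (r\<^sub>1 v) = v" if "v \<in> verts graph\<^sub>1" for v
    using r\<^sub>1 that A(2) by (auto simp: vertex_representatives_def verts)
  have rep\<^sub>2: "r\<^sub>2 v \<in> carrier G" "double_coset G \<Gamma> K\<^sub>2 (r\<^sub>2 v) = v" if "v \<in> verts graph\<^sub>2" for v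
    using r\<^sub>2 that A(2) by (auto simp: vertex_representatives_def verts)
  have arcs: "arcs graph\<^sub>1 = verts graph\<^sub>1 \<times> (\<lambda>k. (k \<otimes> \<Delta>) <# K\<^sub>1) ` K\<^sub>1"
    "arcs graph\<^sub>2 = verts graph\<^sub>2 \<times> (\<lambda>k. (k \<otimes> \<Delta>) <# K\<^sub>2) ` K\<^sub>2"
    unfolding double_coset_left_cosets[OF K\<^sub>1 \<Delta>, symmetric] double_coset_left_cosets[OF K\<^sub>2 \<Delta>, symmetric]
    by (auto simp: graph\<^sub>1 graph\<^sub>2 hecke_digraph_def A(1) double_coset_def)
  have tails: "tail graph\<^sub>1 = fst" "tail graph\<^sub>2 = fst"
    by (simp_all add: graph\<^sub>1 graph\<^sub>2 hecke_digraph_def)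
  have head\<^sub>1: "head graph\<^sub>1 (v, s <# K\<^sub>1) = double_coset G \<Gamma> K\<^sub>1 (r\<^sub>1 v \<otimes> s)"
    if "v \<in> verts graph\<^sub>1" "s \<in> carrier G" for v s
    using that sub r_coset_mult_l_coset rep\<^sub>1
    by (simp add: graph\<^sub>1 hecke_digraph_def A(1) double_coset_def)
  have head\<^sub>2: "head graph\<^sub>2 (v, s <# K\<^sub>2) = double_coset G \<Gamma> K\<^sub>2 (r\<^sub>2 v \<otimes> s)"
    if "v \<in> verts graph\<^sub>2" "s \<in> carrier G" for v s
    using that sub r_coset_mult_l_coset rep\<^sub>2
    by (simp add: graph\<^sub>2 hecke_digraph_def A(1) double_coset_def)
  show "\<exists>\<gamma>\<in>\<Gamma>. \<exists>\<kappa>\<in>K\<^sub>2. r\<^sub>1 a' = \<gamma> \<otimes>\<^bsub>A\<^esub> r\<^sub>2 a \<otimes>\<^bsub>A\<^esub> \<kappa>"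
    if a: "a \<in> verts graph\<^sub>2" and a': "a' \<in> verts graph\<^sub>1" and lift: "vertex_map A K\<^sub>2 a' = a"
  proof -
    have "double_coset G \<Gamma> K\<^sub>2 (r\<^sub>1 a') = double_coset G \<Gamma> K\<^sub>2 (r\<^sub>2 a)"
      using vertex_map[OF rep\<^sub>1(1)[OF a']] rep\<^sub>1(2)[OF a'] rep\<^sub>2(2)[OF a] lift by simp
    then have "r\<^sub>1 a' \<in> double_coset G \<Gamma> K\<^sub>2 (r\<^sub>2 a)"
      using double_coset_refl[OF \<Gamma> K\<^sub>2 rep\<^sub>1(1)[OF a']] by simp
    then show ?thesis by (auto simp: double_coset_def r_coset_def set_mult_def)
  qed
  show "bij_betw (edge_map A K\<^sub>2 a \<kappa>)
      {e \<in> arcs graph\<^sub>1. tail graph\<^sub>1 e = a' \<and> vertex_map A K\<^sub>2 (head graph\<^sub>1 e) = b}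
      {e \<in> arcs graph\<^sub>2. tail graph\<^sub>2 e = a \<and> head graph\<^sub>2 e = b}" (is "bij_betw ?f ?E\<^sub>1 ?E\<^sub>2")
    if a: "a \<in> verts graph\<^sub>2" and a': "a' \<in> verts graph\<^sub>1" and \<gamma>: "\<gamma> \<in> \<Gamma>" and \<kappa>: "\<kappa> \<in> K\<^sub>2"
      and reps: "r\<^sub>1 a' = \<gamma> \<otimes>\<^bsub>A\<^esub> r\<^sub>2 a \<otimes>\<^bsub>A\<^esub> \<kappa>"
  proof -
    note [simp] = \<Delta> rep\<^sub>2(1)[OF a]
    have mem [simp]: "\<kappa> \<in> carrier G" "\<gamma> \<in> carrier G" "\<And>k. k \<in> K\<^sub>1 \<Longrightarrow> k \<in> carrier G" "\<And>k. k \<in> K\<^sub>2 \<Longrightarrow> k \<in> carrier G"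
      using \<gamma> \<kappa> sub by auto
    have f: "edge_map G K\<^sub>2 a \<kappa> (a', (k \<otimes> \<Delta>) <# K\<^sub>1) = (a, (\<kappa> \<otimes> k \<otimes> \<Delta>) <# K\<^sub>2)" if "k \<in> K\<^sub>1" for k
      using that sub by (simp add: edge_map_def lcos_m_assoc m_assoc l_coset_mult_subgroup[OF K\<^sub>1 K\<^sub>2 K\<^sub>1\<^sub>2])
    \<comment> \<open>With \<open>r\<^sub>1 a'\<close> written as \<gamma>
      (\<open>r\<^sub>2 a\<close>) \<kappa>, the factor \<gamma> is absorbed by \<Gamma> on the left
      and \<kappa> passes into the label of the edge. So the edge map respects heads.\<close>
    have heads: "vertex_map G K\<^sub>2 (head graph\<^sub>1 (a', (k \<otimes> \<Delta>) <# K\<^sub>1)) = head graph\<^sub>2 (a, (\<kappa> \<otimes> k \<otimes> \<Delta>) <# K\<^sub>2)"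
      if "k \<in> K\<^sub>1" for k
    proof -
      have "vertex_map G K\<^sub>2 (head graph\<^sub>1 (a', (k \<otimes> \<Delta>) <# K\<^sub>1)) = double_coset G \<Gamma> K\<^sub>2 (r\<^sub>1 a' \<otimes> (k \<otimes> \<Delta>))"
        using that rep\<^sub>1(1)[OF a'] by (simp add: head\<^sub>1[OF a'] vertex_map)
      also have "r\<^sub>1 a' \<otimes> (k \<otimes> \<Delta>) = \<gamma> \<otimes> (r\<^sub>2 a \<otimes> (\<kappa> \<otimes> k \<otimes> \<Delta>))"
        using that by (simp add: reps m_assoc)
      also have "double_coset G \<Gamma> K\<^sub>2 \<dots> = head graph\<^sub>2 (a, (\<kappa> \<otimes> k \<otimes> \<Delta>) <# K\<^sub>2)"
        using that by (simp add: double_coset_left[OF \<Gamma> \<gamma>] head\<^sub>2[OF a])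
      finally show ?thesis .
    qed
    have E\<^sub>1: "?E\<^sub>1 = (\<lambda>k. (a', (k \<otimes> \<Delta>) <# K\<^sub>1)) ` {k \<in> K\<^sub>1. head graph\<^sub>2 (a, (\<kappa> \<otimes> k \<otimes> \<Delta>) <# K\<^sub>2) = b}"
      using a' heads by (auto simp: arcs tails)
    show ?thesis
    proof (rule bij_betw_imageI)
      show "inj_on ?f ?E\<^sub>1"
      proof (rule inj_onI)
        fix e e' assume "e \<in> ?E\<^sub>1" "e' \<in> ?E\<^sub>1" and eq: "?f e = ?f e'"
        then obtain k k' where k: "k \<in> K\<^sub>1" and k': "k' \<in> K\<^sub>1"
          and e: "e = (a', (k \<otimes> \<Delta>) <# K\<^sub>1)" "e' = (a', (k' \<otimes> \<Delta>) <# K\<^sub>1)"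
          unfolding E\<^sub>1 by blast
        then have "(\<kappa> \<otimes> k \<otimes> \<Delta>) <# K\<^sub>2 = (\<kappa> \<otimes> k' \<otimes> \<Delta>) <# K\<^sub>2"
          using eq f by simp
        then obtain \<kappa>' where \<kappa>': "\<kappa>' \<in> K\<^sub>2" "\<kappa> \<otimes> k \<otimes> \<Delta> = \<kappa> \<otimes> k' \<otimes> \<Delta> \<otimes> \<kappa>'"
          using l_coset_eq_iff[OF K\<^sub>2, of "\<kappa> \<otimes> k \<otimes> \<Delta>" "\<kappa> \<otimes> k' \<otimes> \<Delta>"] k k' by auto
        \<comment> \<open>Cancelling \<kappa> leaves the equation to which \<open>separate\<close>
          applies.\<close>
        then have *: "k \<otimes> \<Delta> = k' \<otimes> \<Delta> \<otimes> \<kappa>'"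
          using k k' by (simp add: m_assoc)
        from separate[rule_format, OF k k' \<kappa>'(1) this] show "e = e'"
          using * k k' by (auto simp: e l_coset_eq_iff[OF K\<^sub>1])
      qed
      show "?f ` ?E\<^sub>1 = ?E\<^sub>2"
      proof
        have "\<kappa> \<otimes> k \<in> K\<^sub>2" if "k \<in> K\<^sub>1" for k
          using subgroup.m_closed[OF K\<^sub>2 \<kappa>] that K\<^sub>1\<^sub>2 by auto
        then show "?f ` ?E\<^sub>1 \<subseteq> ?E\<^sub>2"
          using a unfolding E\<^sub>1 by (auto simp: f arcs tails)
        show "?E\<^sub>2 \<subseteq> ?f ` ?E\<^sub>1"
        proof
          fix e assume "e \<in> ?E\<^sub>2"
          then obtain k where k: "k \<in> K\<^sub>2" and e: "e = (a, (k \<otimes> \<Delta>) <# K\<^sub>2)" and b: "head graph\<^sub>2 e = b"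
            by (auto simp: arcs tails)
          \<comment> \<open>The edge map multiplies labels by \<kappa>, so \<open>cover\<close> has
            to be applied to the label with \<kappa> already removed.\<close>
          have "inv \<kappa> \<otimes> k \<in> K\<^sub>2"
            using k \<kappa> K\<^sub>2 by (simp add: subgroup.m_closed subgroup.m_inv_closed)
          from bspec[OF cover this] obtain k' \<kappa>' where k': "k' \<in> K\<^sub>1" and \<kappa>': "\<kappa>' \<in> K\<^sub>2"
            and eq: "inv \<kappa> \<otimes> k \<otimes> \<Delta> = k' \<otimes> \<Delta> \<otimes> \<kappa>'"
            by blast
          have "\<kappa> \<otimes> k' \<otimes> \<Delta> \<otimes> \<kappa>' = \<kappa> \<otimes> (inv \<kappa> \<otimes> k \<otimes> \<Delta>)"
            using k' \<kappa>' by (simp add: eq m_assoc)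
          also have "\<dots> = k \<otimes> \<Delta>"
            using k by (simp flip: m_assoc)
          finally have "\<exists>\<kappa>'\<in>K\<^sub>2. k \<otimes> \<Delta> = \<kappa> \<otimes> k' \<otimes> \<Delta> \<otimes> \<kappa>'"
            using \<kappa>' by (intro bexI[of _ \<kappa>']) simp_all
          then have "(k \<otimes> \<Delta>) <# K\<^sub>2 = (\<kappa> \<otimes> k' \<otimes> \<Delta>) <# K\<^sub>2"
            using k k' by (simp add: l_coset_eq_iff[OF K\<^sub>2])
          then have "e = ?f (a', (k' \<otimes> \<Delta>) <# K\<^sub>1)"
            using f[OF k'] e by simp
          moreover have "(a', (k' \<otimes> \<Delta>) <# K\<^sub>1) \<in> ?E\<^sub>1"
            using k' b calculation f[OF k'] unfolding E\<^sub>1 by auto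
          ultimately show "e \<in> ?f ` ?E\<^sub>1" by blast
        qed
      qed
    qed
  qed
qed

end

section \<open>Groups of points\<close>

context cring
begin

lemma group_grp_points:
  fixes I :: "('n::finite, 'k::field) gl_poly set"
  assumes "algebraic_subgroup I" "\<phi> \<in> ring_hom TR R"
  shows "group (grp_points R \<phi> I)"
proof -
  have "grp_points R \<phi> I = GL R\<lparr>carrier := carrier (grp_points R \<phi> I)\<rparr>"
    by (simp add: grp_points_def)
  then show ?thesis
    using subgroup.subgroup_is_group[OF subgroup_grp_points[OF assms] group_GL] by simp
qed

lemma grp_points_antimono: "J \<subseteq> I \<Longrightarrow> carrier (grp_points R \<phi> I) \<subseteq> carrier (grp_points R \<phi> J)"
  by (auto simp: grp_points_simps)

lemma subgroup_grp_points_of: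
  fixes I J :: "('n::finite, 'k::field) gl_poly set"
  assumes "algebraic_subgroup I" "algebraic_subgroup_of J I" "\<phi> \<in> ring_hom TR R"
  shows "subgroup (carrier (grp_points R \<phi> J)) (grp_points R \<phi> I)"
proof -
  have "grp_points R \<phi> I = GL R\<lparr>carrier := carrier (grp_points R \<phi> I)\<rparr>"
    by (simp add: grp_points_def)
  moreover have "subgroup (carrier (grp_points R \<phi> J)) (GL R\<lparr>carrier := carrier (grp_points R \<phi> I)\<rparr>)"
    using assms by (intro group.subgroup_incl[OF group_GL] subgroup_grp_points grp_points_antimono)
      (auto simp: algebraic_subgroup_of_def)
  ultimately show ?thesis by simp
qed

end

context mat_ring_hom
begin

lemma group_hom_grp_points_map:
  fixes I :: "('n::finite, 'k::field) gl_poly set"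
  assumes I: "algebraic_subgroup I" and \<phi>: "\<phi> \<in> ring_hom TR R"
  shows "group_hom (grp_points R \<phi> I) (grp_points S (h \<circ> \<phi>) I) (\<lambda>g i j. h (g i j))"
proof (intro group_hom.intro group_hom_axioms.intro homI)
  show "group (grp_points R \<phi> I)" "group (grp_points S (h \<circ> \<phi>) I)"
    using R.group_grp_points S.group_grp_points ring_hom_trans[OF \<phi> homh] I \<phi> by auto
next
  fix f g :: "('n, 'a) mat"
  assume f: "f \<in> carrier (grp_points R \<phi> I)" and g: "g \<in> carrier (grp_points R \<phi> I)"
  show "(\<lambda>i j. h (f i j)) \<in> carrier (grp_points S (h \<circ> \<phi>) I)"
    by (rule grp_points_map[OF \<phi> f])
  show "(\<lambda>i j. h ((f \<otimes>\<^bsub>grp_points R \<phi> I\<^esub> g) i j)) =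
      (\<lambda>i j. h (f i j)) \<otimes>\<^bsub>grp_points S (h \<circ> \<phi>) I\<^esub> (\<lambda>i j. h (g i j))"
    unfolding grp_points_simps
    by (rule mat_map_mult; rule R.GL_carrierD(1)) (use f g in \<open>simp_all add: grp_points_simps\<close>)
qed

end

lemma (in group_hom) subgroup_preimage:
  assumes "subgroup K H"
  shows "subgroup {g \<in> carrier G. h g \<in> K} G"
proof (rule G.subgroupI)
  show "{g \<in> carrier G. h g \<in> K} \<noteq> {}"
    using subgroup.one_closed[OF assms] hom_one G.one_closed by (metis (mono_tags) empty_iff mem_Collect_eq)
qed (simp_all add: Collect_mono subgroup.m_closed[OF assms] subgroup.m_inv_closed[OF assms] subset_iff)

subsection \<open>Evaluation of cocharacters\<close>

context cring
begin

text \<open>Exponent laws for negative exponents hold in a group, so the powers of \<open>u\<close>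
  are computed in the unit group of \<open>R\<close> and carried back.\<close>

lemma monoid_algebra_eval_int_pow:
  assumes "\<phi> \<in> ring_hom TR R" and u: "u \<in> Units R"
  shows "monoid_algebra_eval R \<phi> (\<lambda>e :: int. u [^] e)"
proof -
  have pow: "u [^] e = u [^]\<^bsub>units_of R\<^esub> e" for e :: int
    by (simp only: int_pow_def2 units_of_pow[OF u] units_of_inv[OF Units_pow_closed[OF u]])
  have u': "u \<in> carrier (units_of R)"
    using u by (simp add: units_of_carrier)
  have "u [^] e \<in> carrier R" for e :: int
    using group.int_pow_closed[OF units_group u', of e] by (simp add: pow units_of_carrier Units_closed)
  moreover have "u [^] (e + e') = u [^] e \<otimes> u [^] e'" for e e' :: int
    using group.int_pow_mult[OF units_group u'] by (simp add: pow units_of_mult)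
  ultimately show ?thesis
    using assms(1) by unfold_locales simp_all
qed

text \<open>A cocharacter is a point of \<open>T\<close> over k[t, 1/t]. Sending t to a unit is a
  ring homomorphism to \<open>R\<close>, and functoriality carries the point along.\<close>

lemma cochar_eval_closed:
  fixes \<mu> :: "('n::finite, int \<Rightarrow>\<^sub>0 'k::field) mat"
  assumes \<phi>: "\<phi> \<in> ring_hom TR R" and u: "u \<in> Units R" and \<mu>: "cocharacter T \<mu>"
  shows "cochar_eval R \<phi> \<mu> u \<in> carrier (grp_points R \<phi> T)"
proof -
  interpret ev: monoid_algebra_eval R \<phi> "\<lambda>e :: int. u [^] e"
    by (rule monoid_algebra_eval_int_pow[OF \<phi> u])
  let ?ev = "alg_eval R \<phi> (\<lambda>e :: int. u [^] e)"
  interpret mat_ring_hom TR R ?ev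
    using TR_cring is_cring ev.alg_eval_hom
    by (intro mat_ring_hom.intro ring_hom_cring.intro ring_hom_cring_axioms.intro)
  have "?ev \<circ> cst = \<phi>"
    by (simp add: fun_eq_iff ev.alg_eval_single)
  moreover have "cochar_eval R \<phi> \<mu> u = (\<lambda>i j. ?ev (\<mu> i j))"
    by (simp add: cochar_eval_def alg_eval_def)
  ultimately show ?thesis
    using grp_points_map[OF cst_hom, of \<mu> T] \<mu> by (simp add: cocharacter_def)
qed

end

section \<open>Level groups\<close>

text \<open>
  All that matters about a closed point is that its valuation is normalized and nonnegative on
  constants.
\<close>

locale closed_point = valued_field v
  for v :: "'f::field \<Rightarrow> int" +
  fixes \<iota> :: "'k::field \<Rightarrow> 'f"
  assumes \<iota>_hom: "\<iota> \<in> ring_hom TR TR" and constants_integral: "val_ge v 0 (\<iota> c)"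
begin

abbreviation "\<phi> \<equiv> to_completion v \<circ> \<iota>"

lemma \<phi>_hom: "\<phi> \<in> ring_hom TR F\<^sub>v"
  by (rule ring_hom_trans[OF \<iota>_hom to_completion_hom])

lemma \<phi>_hom_integral: "\<phi> \<in> ring_hom TR O\<^sub>v"
  using ring_hom_memE[OF \<phi>_hom] to_completion_integral[OF constants_integral]
  by (intro ring_hom_memI) (auto simp: completed_local_ring_simps)

lemma mat_ring_hom_inclusion: "mat_ring_hom O\<^sub>v F\<^sub>v (\<lambda>a. a)"
  using cring_completed_local_ring cring_completion completed_local_ring_inclusion
  by (intro mat_ring_hom.intro ring_hom_cring.intro ring_hom_cring_axioms.intro)

lemma group_local_group: "algebraic_subgroup G \<Longrightarrow> group (local_group \<iota> G v)"
  unfolding local_group_def using F.group_grp_points \<phi>_hom by blast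

text \<open>Membership in the two groups is tested with inverses formed over different rings;
  functoriality along the inclusion shows that they agree.\<close>

lemma group_hom_integral_local:
  assumes "algebraic_subgroup G"
  shows "group_hom (integral_group \<iota> G v) (local_group \<iota> G v) (\<lambda>g. g)"
  using mat_ring_hom.group_hom_grp_points_map[OF mat_ring_hom_inclusion assms \<phi>_hom_integral]
  by (simp add: integral_group_def local_group_def comp_def)

lemma subgroup_integral_group:
  assumes "algebraic_subgroup G"
  shows "subgroup (carrier (integral_group \<iota> G v)) (local_group \<iota> G v)"
  using group_hom.img_is_subgroup[OF group_hom_integral_local[OF assms]] by simp

context
  fixes p and d :: nat
  assumes p: "p \<in> carrier O\<^sub>v"
begin

abbreviation "J \<equiv> PIdl\<^bsub>O\<^sub>v\<^esub> (p [^]\<^bsub>O\<^sub>v\<^esub> d)"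
abbreviation "red \<equiv> \<lambda>a. J +>\<^bsub>O\<^sub>v\<^esub> a"

lemma mat_ring_hom_reduction: "mat_ring_hom O\<^sub>v (O\<^sub>v Quot J) red"
proof -
  have "ideal J O\<^sub>v"
    using p by (intro O.cgenideal_ideal O.nat_pow_closed)
  then show ?thesis
    unfolding mat_ring_hom_def by (rule ideal.rcos_ring_hom_cring) (rule cring_completed_local_ring)
qed

lemma congruence_preimage_eq:
  "congruence_preimage \<iota> G v p d H =
    {g \<in> carrier (integral_group \<iota> G v).
       (\<lambda>i j. red (g i j)) \<in> carrier (grp_points (O\<^sub>v Quot J) (red \<circ> \<phi>) H)}"
  by (simp add: congruence_preimage_def Let_def comp_assoc)

text \<open>It is the preimage of a subgroup under the reduction homomorphism from the integral
  points of \<open>G\<close> to its points modulo \<open>J\<close>.\<close>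

lemma subgroup_congruence_preimage:
  assumes G: "algebraic_subgroup G" and H: "algebraic_subgroup_of H G"
  shows "subgroup (congruence_preimage \<iota> G v p d H) (local_group \<iota> G v)"
proof -
  interpret mat_ring_hom "O\<^sub>v" "O\<^sub>v Quot J" red
    by (rule mat_ring_hom_reduction)
  interpret red: group_hom "integral_group \<iota> G v" "grp_points (O\<^sub>v Quot J) (red \<circ> \<phi>) G"
      "\<lambda>g i j. red (g i j)"
    unfolding integral_group_def by (rule group_hom_grp_points_map[OF G \<phi>_hom_integral])
  have "subgroup (carrier (grp_points (O\<^sub>v Quot J) (red \<circ> \<phi>) H)) (grp_points (O\<^sub>v Quot J) (red \<circ> \<phi>) G)"
    by (rule S.subgroup_grp_points_of[OF G H ring_hom_trans[OF \<phi>_hom_integral homh]])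
  then have "subgroup (congruence_preimage \<iota> G v p d H) (integral_group \<iota> G v)"
    unfolding congruence_preimage_eq by (rule red.subgroup_preimage)
  then show ?thesis
    using group_hom.subgroup_img_is_subgroup[OF group_hom_integral_local[OF G]] by fastforce
qed

text \<open>Subgroups are given by ideals, so the larger ideal imposes more equations and defines
  the smaller group.\<close>

lemma congruence_preimage_antimono:
  assumes "H' \<subseteq> H"
  shows "congruence_preimage \<iota> G v p d H \<subseteq> congruence_preimage \<iota> G v p d H'"
proof -
  interpret mat_ring_hom "O\<^sub>v" "O\<^sub>v Quot J" red
    by (rule mat_ring_hom_reduction)
  show ?thesis
    unfolding congruence_preimage_eq using S.grp_points_antimono[OF assms] by blast
qed

end

end

text \<open>A constant is the quotient of two forms of degree 0, itself over 1, and the denominator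
  vanishes nowhere. So it lies in every local ring.\<close>

lemma closed_points_closed_point:
  fixes \<iota> :: "'k::field \<Rightarrow> 'f::field" and \<xi> :: "'m::finite \<Rightarrow> 'f"
  assumes \<iota>: "\<iota> \<in> ring_hom TR TR" and v: "v \<in> closed_points \<iota> \<xi>"
  shows "closed_point v \<iota>"
proof unfold_locales
  show "normalized_valuation v"
    using v by (simp add: closed_points_def)
  show "\<iota> \<in> ring_hom TR TR" by fact
  fix c
  obtain P where P: "{a. val_ge v 0 a} = local_ring \<iota> \<xi> P"
    using v by (auto simp: closed_points_def)
  have eval: "mpoly_eval TR \<iota> \<xi> (cst b) = \<iota> b" "mpoly_eval TR to_ac P (cst b) = to_ac b" for b
    using cring.mpoly_eval_cst[OF TR_cring] \<iota> to_ac_hom by auto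
  have "homogeneous 0 (cst b :: ('m, 'k) mpoly)" for b
    by (simp add: homogeneous_def)
  moreover have "\<iota> 1 = 1"
    using ring_hom_one[OF \<iota>] by simp
  ultimately have "\<iota> c = mpoly_eval TR \<iota> \<xi> (cst c) / mpoly_eval TR \<iota> \<xi> (cst 1) \<and>
      homogeneous 0 (cst c :: ('m, 'k) mpoly) \<and> homogeneous 0 (cst 1 :: ('m, 'k) mpoly) \<and>
      mpoly_eval TR to_ac P (cst 1) \<noteq> 0"
    by (simp add: eval del: single_one)
  then have "\<iota> c \<in> local_ring \<iota> \<xi> P"
    unfolding local_ring_def by blast
  then show "val_ge v 0 (\<iota> c)"
    using P by auto
qed

text \<open>The diagonal map is a homomorphism in each component, hence into the full product, and
  its image is a subgroup.\<close>

lemma subgroup_rational_points: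
  assumes G: "algebraic_subgroup G" and \<iota>: "\<iota> \<in> ring_hom TR TR"
    and points: "\<And>y. y \<in> \<X> \<Longrightarrow> closed_point y \<iota>"
  shows "subgroup (rational_points \<iota> \<X> G) (product_group \<X> (local_group \<iota> G))"
proof -
  have loc: "group_hom (grp_points TR \<iota> G) (local_group \<iota> G y) (\<lambda>\<gamma> i j. to_completion y (\<gamma> i j))"
    if "y \<in> \<X>" for y
  proof -
    interpret closed_point y \<iota> by (rule points[OF that])
    interpret mat_ring_hom TR "completion y" "to_completion y"
      using TR_cring cring_completion to_completion_hom
      by (intro mat_ring_hom.intro ring_hom_cring.intro ring_hom_cring_axioms.intro)
    show ?thesis
      unfolding local_group_def by (rule group_hom_grp_points_map[OF G \<iota>])
  qed
  have "group_hom (grp_points TR \<iota> G) (product_group \<X> (local_group \<iota> G))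
      (\<lambda>\<gamma>. \<lambda>y\<in>\<X>. \<lambda>i j. to_completion y (\<gamma> i j))"
  proof (intro group_hom.intro group_hom_axioms.intro homI)
    show "group (grp_points TR \<iota> G)"
      by (rule cring.group_grp_points[OF TR_cring G \<iota>])
    show "group (product_group \<X> (local_group \<iota> G))"
      using loc by (intro product_group) (simp add: group_hom_def)
  qed (auto intro!: restrict_ext simp: group_hom.hom_closed[OF loc] group_hom.hom_mult[OF loc])
  from group_hom.img_is_subgroup[OF this] show ?thesis
    by (simp add: rational_points_def)
qed

theorem proposition1p3:
  fixes \<iota> :: "'k::{field,finite} \<Rightarrow> 'f::field"
    and \<xi> :: "'m::finite \<Rightarrow> 'f"
    and \<X> :: "('f \<Rightarrow> int) set"
    and x :: "'f \<Rightarrow> int"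
    and \<pi> :: "('f \<Rightarrow> int) \<Rightarrow> (nat \<Rightarrow> 'f) set"
    and G T B :: "('n::finite, 'k) gl_poly set"
    and \<mu> :: "('n, int \<Rightarrow>\<^sub>0 'k) mat"
    and D :: "('f \<Rightarrow> int) \<Rightarrow> nat"
    and H\<^sub>1 H\<^sub>2 :: "('f \<Rightarrow> int) \<Rightarrow> ('n, 'k) gl_poly set"
  assumes curve: "smooth_projective_geom_connected_curve \<iota> \<xi>"
    and \<X>: "\<X> = closed_points \<iota> \<xi>"
    and x: "x \<in> \<X>"
    and uniformizers: "\<forall>y\<in>\<X>. uniformizer y (\<pi> y)"
    and G: "connected_reductive G"
    and T: "split_maximal_torus T G"
    and B: "borel_subgroup B G" "algebraic_subgroup_of T B"
    and \<mu>: "dominant_cocharacter T B \<mu>"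
    and D: "effective_divisor \<X> D"
    and H\<^sub>1: "ramification_datum \<X> G D H\<^sub>1"
    and H\<^sub>2: "ramification_datum \<X> G D H\<^sub>2"
    and H\<^sub>1_trivial: "\<forall>y\<in>supp \<X> D. y \<noteq> x \<longrightarrow> H\<^sub>1 y = trivial_subgroup"
    and H_at_x: "x \<in> supp \<X> D \<longrightarrow> H\<^sub>1 x = H\<^sub>2 x"
    and A: "A = adelic_group \<iota> \<X> G"
    and \<Gamma>: "\<Gamma> = rational_points \<iota> \<X> G"
    and \<Delta>: "\<Delta> = hecke_element \<iota> \<X> \<pi> x \<mu>"
    and K\<^sub>1: "K\<^sub>1 = level_group \<iota> \<X> \<pi> G D H\<^sub>1"
    and K\<^sub>2: "K\<^sub>2 = level_group \<iota> \<X> \<pi> G D H\<^sub>2"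
    and r\<^sub>1: "vertex_representatives A \<Gamma> K\<^sub>1 r\<^sub>1"
    and r\<^sub>2: "vertex_representatives A \<Gamma> K\<^sub>2 r\<^sub>2"
    and graph\<^sub>1: "graph\<^sub>1 = hecke_digraph A \<Gamma> K\<^sub>1 \<Delta> r\<^sub>1"
    and graph\<^sub>2: "graph\<^sub>2 = hecke_digraph A \<Gamma> K\<^sub>2 \<Delta> r\<^sub>2"
  shows "(\<forall>g\<in>carrier A. vertex_map A K\<^sub>2 (double_coset A \<Gamma> K\<^sub>1 g) = double_coset A \<Gamma> K\<^sub>2 g) \<and>
    vertex_map A K\<^sub>2 ` verts graph\<^sub>1 = verts graph\<^sub>2 \<and>
    (\<forall>a\<in>verts graph\<^sub>2. \<forall>b\<in>verts graph\<^sub>2. \<forall>a'\<in>verts graph\<^sub>1. vertex_map A K\<^sub>2 a' = a \<longrightarrow>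
       (\<exists>\<gamma>\<in>\<Gamma>. \<exists>\<kappa>\<in>K\<^sub>2. r\<^sub>1 a' = \<gamma> \<otimes>\<^bsub>A\<^esub> r\<^sub>2 a \<otimes>\<^bsub>A\<^esub> \<kappa>) \<and>
       (\<forall>\<gamma>\<in>\<Gamma>. \<forall>\<kappa>\<in>K\<^sub>2. r\<^sub>1 a' = \<gamma> \<otimes>\<^bsub>A\<^esub> r\<^sub>2 a \<otimes>\<^bsub>A\<^esub> \<kappa> \<longrightarrow>
          bij_betw (edge_map A K\<^sub>2 a \<kappa>)
            {e \<in> arcs graph\<^sub>1. tail graph\<^sub>1 e = a' \<and> vertex_map A K\<^sub>2 (head graph\<^sub>1 e) = b}
            {e \<in> arcs graph\<^sub>2. tail graph\<^sub>2 e = a \<and> head graph\<^sub>2 e = b}))"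
proof -
  let ?P = "product_group \<X> (local_group \<iota> G)"
  have \<iota>: "\<iota> \<in> ring_hom TR TR"
    using curve by (simp add: smooth_projective_geom_connected_curve_def)
  have alg: "algebraic_subgroup G"
    using G by (simp add: connected_reductive_def)
  have points: "closed_point y \<iota>" if "y \<in> \<X>" for y
    using closed_points_closed_point[OF \<iota>] that by (simp add: \<X>)
  have local_grp: "group (local_group \<iota> G y)" if "y \<in> \<X>" for y
    by (rule closed_point.group_local_group[OF points[OF that] alg])
  interpret P: group ?P
    by (rule product_group[OF local_grp])
  have unif: "\<pi> y \<in> carrier (completed_local_ring y)" "\<pi> y \<in> Units (completion y)" if "y \<in> \<X>" for y
  proof -
    interpret closed_point y \<iota> by (rule points[OF that])
    show "\<pi> y \<in> carrier (completed_local_ring y)" "\<pi> y \<in> Units (completion y)"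
      using uniformizers that uniformizer_unit by (auto simp: uniformizer_def)
  qed
  \<comment> \<open>Local factor of the level group. Both level groups are products of such factors,
    so subgroup and inclusion claims can be checked place by place.\<close>
  define C where "C H y = (if y \<in> supp \<X> D then congruence_preimage \<iota> G y (\<pi> y) (D y) (H y)
      else carrier (integral_group \<iota> G y))" for H :: "('f \<Rightarrow> int) \<Rightarrow> ('n, 'k) gl_poly set" and y
  have K: "K\<^sub>1 = PiE \<X> (C H\<^sub>1)" "K\<^sub>2 = PiE \<X> (C H\<^sub>2)"
    by (simp_all add: K\<^sub>1 K\<^sub>2 level_group_def C_def[abs_def])
  have C_subgroup: "subgroup (C H y) (local_group \<iota> G y)" if "ramification_datum \<X> G D H" "y \<in> \<X>" for H y
    using that closed_point.subgroup_congruence_preimage[OF points unif(1) alg]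
      closed_point.subgroup_integral_group[OF points alg]
    by (auto simp: C_def ramification_datum_def)
  have C_x: "C H\<^sub>1 x = C H\<^sub>2 x"
    using H_at_x by (simp add: C_def)
  have C_mono: "C H\<^sub>1 y \<subseteq> C H\<^sub>2 y" if "y \<in> \<X>" for y
  proof (cases "y \<in> supp \<X> D \<and> y \<noteq> x")
    case True
    \<comment> \<open>Every Hopf ideal is killed by the counit, hence contained in the ideal of the
      trivial group; in terms of groups, the trivial group lies in
      \<open>H\<^sub>2 y\<close>.\<close>
    have "algebraic_subgroup (H\<^sub>2 y)"
      using H\<^sub>2 True by (auto simp: ramification_datum_def algebraic_subgroup_of_def)
    then have "H\<^sub>2 y \<subseteq> H\<^sub>1 y"
      using H\<^sub>1_trivial True by (auto simp: trivial_subgroup_def algebraic_subgroup_def)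
    then show ?thesis
      using True closed_point.congruence_preimage_antimono[OF points[OF that] unif(1)[OF that]]
      by (simp add: C_def)
  next
    \<comment> \<open>Either there is no level structure at \<open>y\<close>, or \<open>y\<close> is
      \<open>x\<close>; the two factors coincide in both cases.\<close>
    case False
    then show ?thesis using C_x by (auto simp: C_def)
  qed
  note C\<^sub>1 = C_subgroup[OF H\<^sub>1] and C\<^sub>2 = C_subgroup[OF H\<^sub>2]
  have \<Delta>_off: "\<Delta> y = \<one>\<^bsub>local_group \<iota> G y\<^esub>" if "y \<in> \<X>" "y \<noteq> x" for y
    using that by (simp add: \<Delta> hecke_element_def local_group_def grp_points_simps)
  have \<Delta>_x: "\<Delta> x \<in> carrier (local_group \<iota> G x)"
  proof -
    interpret closed_point x \<iota> by (rule points[OF x])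
    have "cochar_eval (completion x) \<phi> \<mu> (\<pi> x) \<in> carrier (grp_points (completion x) \<phi> T)"
      using \<mu> by (intro F.cochar_eval_closed \<phi>_hom unif(2) x) (simp add: dominant_cocharacter_def)
    \<comment> \<open>An inclusion of ideals: the torus lies in the group.\<close>
    moreover have "G \<subseteq> T"
      using T by (simp add: split_maximal_torus_def algebraic_subgroup_of_def)
    ultimately have "cochar_eval (completion x) \<phi> \<mu> (\<pi> x) \<in> carrier (grp_points (completion x) \<phi> G)"
      using F.grp_points_antimono[of G T] by blast
    then show ?thesis
      using x by (simp add: \<Delta> hecke_element_def local_group_def)
  qed
  have \<Delta>_local: "\<Delta> y \<in> carrier (local_group \<iota> G y)" if "y \<in> \<X>" for y
    using \<Delta>_x \<Delta>_off that local_grp monoid.one_closed[OF group.axioms(1)] by (cases "y = x") auto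
  have \<Delta>_P: "\<Delta> \<in> carrier ?P"
    using \<Delta>_local by (auto simp: \<Delta> hecke_element_def)
  have cover: "\<forall>k\<in>K\<^sub>2. \<exists>k'\<in>K\<^sub>1. \<exists>\<kappa>\<in>K\<^sub>2. k \<otimes>\<^bsub>?P\<^esub> \<Delta> = k' \<otimes>\<^bsub>?P\<^esub> \<Delta> \<otimes>\<^bsub>?P\<^esub> \<kappa>"
  proof (intro ballI bexI)
    fix k assume k: "k \<in> K\<^sub>2"
    let ?k' = "\<lambda>y\<in>\<X>. if y = x then k y else \<one>\<^bsub>local_group \<iota> G y\<^esub>"
    let ?\<kappa> = "\<lambda>y\<in>\<X>. if y = x then \<one>\<^bsub>local_group \<iota> G y\<^esub> else k y"
    have k_y: "k y \<in> C H\<^sub>2 y" if "y \<in> \<X>" for y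
      using k that by (auto simp: K)
    show "?k' \<in> K\<^sub>1" "?\<kappa> \<in> K\<^sub>2"
      using k_y C_x subgroup.one_closed[OF C\<^sub>1] subgroup.one_closed[OF C\<^sub>2] by (auto simp: K)
    have "k y \<otimes>\<^bsub>local_group \<iota> G y\<^esub> \<Delta> y =
        ?k' y \<otimes>\<^bsub>local_group \<iota> G y\<^esub> \<Delta> y \<otimes>\<^bsub>local_group \<iota> G y\<^esub> ?\<kappa> y" if y: "y \<in> \<X>" for y
    proof -
      interpret L: group "local_group \<iota> G y" by (rule local_grp[OF y])
      \<comment> \<open>The first equation settles the component at \<open>x\<close>, where \<kappa>
        is 1; the second settles the others, where both k' and the Hecke element are 1.\<close>
      have "k y \<otimes>\<^bsub>local_group \<iota> G y\<^esub> \<Delta> y \<otimes>\<^bsub>local_group \<iota> G y\<^esub> \<one>\<^bsub>local_group \<iota> G y\<^esub> =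
            k y \<otimes>\<^bsub>local_group \<iota> G y\<^esub> \<Delta> y"
        "\<one>\<^bsub>local_group \<iota> G y\<^esub> \<otimes>\<^bsub>local_group \<iota> G y\<^esub> \<one>\<^bsub>local_group \<iota> G y\<^esub> \<otimes>\<^bsub>local_group \<iota> G y\<^esub> k y =
            k y \<otimes>\<^bsub>local_group \<iota> G y\<^esub> \<one>\<^bsub>local_group \<iota> G y\<^esub>"
        using subgroup.mem_carrier[OF C\<^sub>2[OF y] k_y[OF y]] \<Delta>_local[OF y] by simp_all
      then show ?thesis
        using y \<Delta>_off[OF y] by auto
    qed
    then show "k \<otimes>\<^bsub>?P\<^esub> \<Delta> = ?k' \<otimes>\<^bsub>?P\<^esub> \<Delta> \<otimes>\<^bsub>?P\<^esub> ?\<kappa>"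
      by (auto intro!: restrict_ext)
  qed
  have separate: "\<forall>k\<in>K\<^sub>1. \<forall>k'\<in>K\<^sub>1. \<forall>\<kappa>\<in>K\<^sub>2.
      k \<otimes>\<^bsub>?P\<^esub> \<Delta> = k' \<otimes>\<^bsub>?P\<^esub> \<Delta> \<otimes>\<^bsub>?P\<^esub> \<kappa> \<longrightarrow> \<kappa> \<in> K\<^sub>1"
  proof (intro ballI impI)
    fix k k' \<kappa>
    assume k: "k \<in> K\<^sub>1" and k': "k' \<in> K\<^sub>1" and \<kappa>: "\<kappa> \<in> K\<^sub>2"
      and eq: "k \<otimes>\<^bsub>?P\<^esub> \<Delta> = k' \<otimes>\<^bsub>?P\<^esub> \<Delta> \<otimes>\<^bsub>?P\<^esub> \<kappa>"
    have "\<kappa> y \<in> C H\<^sub>1 y" if y: "y \<in> \<X>" for y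
    proof (cases "y = x")
      case True
      then show ?thesis using \<kappa> y C_x by (auto simp: K)
    next
      case False
      interpret L: group "local_group \<iota> G y" by (rule local_grp[OF y])
      have mem: "k y \<in> C H\<^sub>1 y" "k' y \<in> C H\<^sub>1 y" "\<kappa> y \<in> C H\<^sub>2 y"
        using k k' \<kappa> y by (auto simp: K)
      note carr = subgroup.mem_carrier[OF C\<^sub>1[OF y] mem(1)] subgroup.mem_carrier[OF C\<^sub>1[OF y] mem(2)]
        subgroup.mem_carrier[OF C\<^sub>2[OF y] mem(3)]
      have "k y = k' y \<otimes>\<^bsub>local_group \<iota> G y\<^esub> \<kappa> y"
        using fun_cong[OF eq, of y] y carr \<Delta>_off[OF y False] by simp
      then have "\<kappa> y = inv\<^bsub>local_group \<iota> G y\<^esub> (k' y) \<otimes>\<^bsub>local_group \<iota> G y\<^esub> k y"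
        using carr by (simp flip: L.m_assoc)
      then show ?thesis
        using mem subgroup.m_closed[OF C\<^sub>1[OF y]] subgroup.m_inv_closed[OF C\<^sub>1[OF y]] by simp
    qed
    then show "\<kappa> \<in> K\<^sub>1"
      using \<kappa> by (auto simp: K PiE_iff)
  qed
  have K_subgroup: "subgroup K\<^sub>1 ?P" "subgroup K\<^sub>2 ?P"
    using C\<^sub>1 C\<^sub>2 by (simp_all add: K PiE_subgroup_product_group[of \<X> "local_group \<iota> G"] local_grp)
  have K_mono: "K\<^sub>1 \<subseteq> K\<^sub>2"
    unfolding K by (rule PiE_mono[OF C_mono])
  have \<Gamma>_subgroup: "subgroup \<Gamma> ?P"
    unfolding \<Gamma> by (rule subgroup_rational_points[OF alg \<iota> points])
  have A_eq: "A = ?P\<lparr>carrier := carrier A\<rparr>" and A_sub: "carrier A \<subseteq> carrier ?P"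
    by (auto simp: A adelic_group_def)
  note level_change = P.hecke_digraph_level_change[OF A_eq A_sub \<Gamma>_subgroup K_subgroup K_mono \<Delta>_P
      cover separate r\<^sub>1 r\<^sub>2 graph\<^sub>1 graph\<^sub>2]
  show ?thesis
    by (intro conjI ballI impI level_change)
qed

end
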